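(* Let $\rho:(0,\infty)\to(0,\infty)$ be any function and let $\Phi,\Psi\in\bar{\mathcal{P}}_Y$. (i) Assume there is a constant $A>0$ such that for all $r\in(0,\infty)$ $$\Big(\sup_{0<t\le r}\rho(t)\Big)\,\Phi^{-1}(1/r^n)\le A\,\Psi^{-1}(1/r^n).$$ Then for every constant $C_0>0$ there exists a constant $C_1>0$ such that for all $f\in L^{\Phi}(\mathbb{R}^n)$ with $f\not\equiv0$ and all $x\in\mathbb{R}^n$, $$\Psi\!\left(\frac{M_\rho f(x)}{C_1\|f\|_{L^\Phi}}\right)\le\Phi\!\left(\frac{Mf(x)}{C_0\|f\|_{L^\Phi}}\right).$$ Consequently $M_\rho$ is bounded from $L^\Phi(\mathbb{R}^n)$ to $\mathrm{w}L^\Psi(\mathbb{R}^n)$. Moreover, if $\Phi\in\bar\nabla_2$, then $M_\rho$ is bounded from $L^\Phi(\mathbb{R}^n)$ to $L^\Psi(\mathbb{R}^n)$. (ii) Conversely, if $M_\rho$ is bounded from $L^\Phi(\mathbb{R}^n)$ to $\mathrm{w}L^\Psi(\mathbb{R}^n)$, then there is a constant $A>0$ such that the inequality in (i) holds for all $r\in(0,\infty)$.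
   Context: $\bar{\mathcal{P}}$ is the set of all increasing (nondecreasing) $\Phi:[0,\infty]\to[0,\infty]$ such that, with $a(\Phi)=\sup\{t\ge0:\Phi(t)=0\}$ and $b(\Phi)=\inf\{t\ge0:\Phi(t)=\infty\}$ ($\sup\emptyset=0$, $\inf\emptyset=\infty$): $0\le a(\Phi)<\infty$, $0<b(\Phi)\le\infty$; $\lim_{t\to0+}\Phi(t)=\Phi(0)=0$; $\Phi$ is left continuous on $[0,b(\Phi))$; if $b(\Phi)=\infty$ then $\lim_{t\to\infty}\Phi(t)=\Phi(\infty)=\infty$; if $b(\Phi)<\infty$ then $\lim_{t\to b(\Phi)-0}\Phi(t)=\Phi(b(\Phi))$. The generalized inverse is $\Phi^{-1}(u)=\inf\{t\ge0:\Phi(t)>u\}$ for $u<\infty$, $\Phi^{-1}(\infty)=\infty$. A Young function is a $\Phi\in\bar{\mathcal{P}}$ that is convex on $[0,b(\Phi))$. Write $\Phi\approx\Psi$ if there is $C>0$ with $\Phi(t/C)\le\Psi(t)\le\Phi(Ct)$ for all $t\in[0,\infty]$; $\bar{\mathcal{P}}_Y$ is the set of $\Phi\in\bar{\mathcal{P}}$ with $\Phi\approx\Psi$ for some Young function $\Psi$. $\bar\nabla_2$ is the set of $\Phi\in\bar{\mathcal{P}}$ for which there is $k>1$ with $\Phi(t)\le\frac1{2k}\Phi(kt)$ for all $t>0$. For $\Phi\in\bar{\mathcal{P}}_Y$: $L^\Phi(\mathbb{R}^n)$ is the set of measurable $f$ with $\int_{\mathbb{R}^n}\Phi(\epsilon|f|)\,dx<\infty$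 for some $\epsilon>0$, with $\|f\|_{L^\Phi}=\inf\{\lambda>0:\int\Phi(|f(x)|/\lambda)\,dx\le1\}$; $\mathrm{w}L^\Phi(\mathbb{R}^n)$ is the set of measurable $f$ with $\sup_{t>0}\Phi(t)\,m(\epsilon f,t)<\infty$ for some $\epsilon>0$, where $m(f,t)=|\{x:|f(x)|>t\}|$, with $\|f\|_{\mathrm{w}L^\Phi}=\inf\{\lambda>0:\sup_{t>0}\Phi(t)m(f/\lambda,t)\le1\}$. Boundedness of an operator $T$ from $L^\Phi$ to $\mathrm{w}L^\Psi$ means $\|Tf\|_{\mathrm{w}L^\Psi}\le C\|f\|_{L^\Phi}$ for all $f\in L^\Phi$ (similarly for $L^\Psi$). $B(z,r)$ is the open ball of center $z$ and radius $r$. $Mf(x)=\sup_{B\ni x}\frac1{|B|}\int_B|f|$ is the Hardy–Littlewood maximal operator (supremum over balls containing $x$), and $M_\rho f(x)=\sup_{B(z,r)\ni x}\rho(r)\frac1{|B(z,r)|}\int_{B(z,r)}|f(y)|\,dy$. *)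

theory Defs
  imports "HOL-Analysis.Analysis"
begin

definition a_of :: "(ennreal \<Rightarrow> ennreal) \<Rightarrow> ennreal" where
  "a_of \<Phi> = Sup {t. \<Phi> t = 0}"

definition b_of :: "(ennreal \<Rightarrow> ennreal) \<Rightarrow> ennreal" where
  "b_of \<Phi> = Inf {t. \<Phi> t = top}"

definition Pbar :: "(ennreal \<Rightarrow> ennreal) set" where
  "Pbar = {\<Phi>. mono \<Phi> \<and> a_of \<Phi> < top \<and> 0 < b_of \<Phi>
      \<and> \<Phi> 0 = 0 \<and> (\<Phi> \<longlongrightarrow> 0) (at_right 0)
      \<and> (\<forall>t. 0 < t \<and> t < b_of \<Phi> \<longrightarrow> (\<Phi> \<longlongrightarrow> \<Phi> t) (at_left t))
      \<and> (b_of \<Phi> = top \<longrightarrow> (\<Phi> \<longlongrightarrow> top) (at_left top) \<and> \<Phi> top = top)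
      \<and> (b_of \<Phi> < top \<longrightarrow> (\<Phi> \<longlongrightarrow> \<Phi> (b_of \<Phi>)) (at_left (b_of \<Phi>)))}"

definition gen_inv :: "(ennreal \<Rightarrow> ennreal) \<Rightarrow> ennreal \<Rightarrow> ennreal" where
  "gen_inv \<Phi> u = (if u = top then top else Inf {t. \<Phi> t > u})"

definition young :: "(ennreal \<Rightarrow> ennreal) \<Rightarrow> bool" where
  "young \<Phi> \<longleftrightarrow> \<Phi> \<in> Pbar \<and>
     (\<forall>s t (l::real). s < b_of \<Phi> \<longrightarrow> t < b_of \<Phi> \<longrightarrow> 0 \<le> l \<longrightarrow> l \<le> 1 \<longrightarrow>
        \<Phi> (ennreal l * s + ennreal (1 - l) * t) \<le> ennreal l * \<Phi> s + ennreal (1 - l) * \<Phi> t)"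

definition equiv_fun :: "(ennreal \<Rightarrow> ennreal) \<Rightarrow> (ennreal \<Rightarrow> ennreal) \<Rightarrow> bool" where
  "equiv_fun \<Phi> \<Psi> \<longleftrightarrow> (\<exists>C::real>0. \<forall>t. \<Phi> (t / ennreal C) \<le> \<Psi> t \<and> \<Psi> t \<le> \<Phi> (ennreal C * t))"

definition PbarY :: "(ennreal \<Rightarrow> ennreal) set" where
  "PbarY = {\<Phi>. \<Phi> \<in> Pbar \<and> (\<exists>\<Psi>. young \<Psi> \<and> equiv_fun \<Phi> \<Psi>)}"

definition nabla2 :: "(ennreal \<Rightarrow> ennreal) set" where
  "nabla2 = {\<Phi>. \<Phi> \<in> Pbar \<and> (\<exists>k::real>1. \<forall>t>0. \<Phi> t \<le> \<Phi> (ennreal k * t) / ennreal (2 * k))}"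

text \<open>Orlicz spaces, for real-valued measurable functions on \<open>\<real>\<^sup>n\<close> (modelled as a Euclidean space).
  Norms are defined on the nonnegative extended-valued function \<open>|f|\<close>, valued in \<open>[0,\<infinity>]\<close>
  (the infimum of the empty set being \<open>\<infinity>\<close>).\<close>

definition orlicz_space :: "(ennreal \<Rightarrow> ennreal) \<Rightarrow> ('a::euclidean_space \<Rightarrow> real) set" where
  "orlicz_space \<Phi> = {f. f \<in> borel_measurable lebesgue \<and>
      (\<exists>\<epsilon>::real>0. (\<integral>\<^sup>+ x. \<Phi> (ennreal (\<epsilon> * \<bar>f x\<bar>)) \<partial>lebesgue) < top)}"

definition orlicz_norm :: "(ennreal \<Rightarrow> ennreal) \<Rightarrow> ('a::euclidean_space \<Rightarrow> ennreal) \<Rightarrow> ennreal" where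
  "orlicz_norm \<Phi> g = Inf {ennreal c | c::real. c > 0 \<and>
      (\<integral>\<^sup>+ x. \<Phi> (g x / ennreal c) \<partial>lebesgue) \<le> 1}"

definition distrib :: "('a::euclidean_space \<Rightarrow> ennreal) \<Rightarrow> ennreal \<Rightarrow> ennreal" where
  "distrib g t = emeasure lebesgue {x. g x > t}"

definition weak_orlicz_norm :: "(ennreal \<Rightarrow> ennreal) \<Rightarrow> ('a::euclidean_space \<Rightarrow> ennreal) \<Rightarrow> ennreal" where
  "weak_orlicz_norm \<Phi> g = Inf {ennreal c | c::real. c > 0 \<and>
      (SUP t\<in>{0<..}. \<Phi> t * distrib (\<lambda>x. g x / ennreal c) t) \<le> 1}"

definition ball_avg :: "('a::euclidean_space \<Rightarrow> real) \<Rightarrow> 'a \<Rightarrow> real \<Rightarrow> ennreal" where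
  "ball_avg f z r = (\<integral>\<^sup>+ y\<in>ball z r. ennreal \<bar>f y\<bar> \<partial>lebesgue) / emeasure lebesgue (ball z r)"

definition HL_max :: "('a::euclidean_space \<Rightarrow> real) \<Rightarrow> 'a \<Rightarrow> ennreal" where
  "HL_max f x = (SUP zr\<in>{(z, r). r > 0 \<and> x \<in> ball z r}. ball_avg f (fst zr) (snd zr))"

definition frac_max :: "(real \<Rightarrow> real) \<Rightarrow> ('a::euclidean_space \<Rightarrow> real) \<Rightarrow> 'a \<Rightarrow> ennreal" where
  "frac_max \<rho> f x = (SUP zr\<in>{(z, r). r > 0 \<and> x \<in> ball z r}.
      ennreal (\<rho> (snd zr)) * ball_avg f (fst zr) (snd zr))"

definition bounded_weak ::
  "(('a::euclidean_space \<Rightarrow> real) \<Rightarrow> 'a \<Rightarrow> ennreal) \<Rightarrow> (ennreal \<Rightarrow> ennreal) \<Rightarrow> (ennreal \<Rightarrow> ennreal) \<Rightarrow> bool" where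
  "bounded_weak T \<Phi> \<Psi> \<longleftrightarrow> (\<exists>C::real>0. \<forall>f\<in>orlicz_space \<Phi>.
      T f \<in> borel_measurable lebesgue \<and>
      weak_orlicz_norm \<Psi> (T f) \<le> ennreal C * orlicz_norm \<Phi> (\<lambda>x. ennreal \<bar>f x\<bar>))"

definition bounded_strong ::
  "(('a::euclidean_space \<Rightarrow> real) \<Rightarrow> 'a \<Rightarrow> ennreal) \<Rightarrow> (ennreal \<Rightarrow> ennreal) \<Rightarrow> (ennreal \<Rightarrow> ennreal) \<Rightarrow> bool" where
  "bounded_strong T \<Phi> \<Psi> \<longleftrightarrow> (\<exists>C::real>0. \<forall>f\<in>orlicz_space \<Phi>.
      T f \<in> borel_measurable lebesgue \<and>
      orlicz_norm \<Psi> (T f) \<le> ennreal C * orlicz_norm \<Phi> (\<lambda>x. ennreal \<bar>f x\<bar>))"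

definition cond_i :: "(real \<Rightarrow> real) \<Rightarrow> (ennreal \<Rightarrow> ennreal) \<Rightarrow> (ennreal \<Rightarrow> ennreal) \<Rightarrow> nat \<Rightarrow> real \<Rightarrow> bool" where
  "cond_i \<rho> \<Phi> \<Psi> n A \<longleftrightarrow> (\<forall>r::real>0.
      (SUP t\<in>{0<..r}. ennreal (\<rho> t)) * gen_inv \<Phi> (ennreal (1 / r ^ n))
        \<le> ennreal A * gen_inv \<Psi> (ennreal (1 / r ^ n)))"

end

theory Submission
  imports Defs
begin

text \<open>
  Everything about a function \<open>\<Phi>\<close> equivalent to a Young function follows from two facts: the Galois
  connection \<open>t \<le> \<Phi>\<^sup>-\<^sup>1(v) \<longleftrightarrow> \<Phi>(t) \<le> v\<close>, and \<open>\<alpha> \<Phi>(t) \<le> \<Phi>(K \<alpha> t)\<close> for \<open>\<alpha> \<ge> 1\<close> with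
  a constant \<open>K\<close>, which replaces convexity and yields Jensen's inequality up to a constant.

  For the pointwise estimate take \<open>v = 1 / r\<^sub>0\<^sup>n \<ge> \<Phi>(Mf(x) / (C\<^sub>0 \<parallel>f\<parallel>))\<close>. An average over a ball of radius
  \<open>r \<le> r\<^sub>0\<close> is at most \<open>Mf(x) \<le> C\<^sub>0 \<parallel>f\<parallel> \<Phi>\<^sup>-\<^sup>1(v)\<close>; for \<open>r > r\<^sub>0\<close>, Jensen bounds it by a multiple of
  \<open>\<parallel>f\<parallel> \<Phi>\<^sup>-\<^sup>1(1 / r\<^sup>n)\<close>. In both cases the condition on \<open>\<rho>\<close> gives \<open>M\<^sub>\<rho> f(x) \<le> C\<^sub>1 \<parallel>f\<parallel> \<Psi>\<^sup>-\<^sup>1(v)\<close>.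
  Boundedness of \<open>M\<^sub>\<rho>\<close> is thereby reduced to that of \<open>M\<close>: the weak type follows from Jensen and Vitali's
  covering lemma, the strong type from a sum over the dyadic levels \<open>k\<^sup>j\<close>, which the \<open>\<nabla>\<^sub>2\<close> condition makes
  geometric. The converse tests \<open>M\<^sub>\<rho>\<close> on indicators of balls, on which \<open>M\<^sub>\<rho>\<close> is at least
  \<open>sup\<^sub>t\<^sub>\<le>\<^sub>r \<rho>(t)\<close>.
\<close>

section \<open>Measurability of monotone functions\<close>

text \<open>Superlevel sets are upward closed in a linear order, hence of the form
  \<open>{i..}\<close> or \<open>{i<..}\<close> with \<open>i\<close> the infimum, according to
  whether the infimum belongs to the set.\<close>

lemma mono_ennreal_borel_measurable:
  fixes F :: "ennreal \<Rightarrow> ennreal"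
  assumes "mono F"
  shows "F \<in> borel_measurable borel"
proof (rule borel_measurableI_greater)
  fix y
  let ?S = "{x \<in> space borel. y < F x}"
  have up: "x' \<in> ?S" if "x \<in> ?S" "x \<le> x'" for x x'
    using that assms by (auto simp: mono_def intro: less_le_trans)
  show "?S \<in> sets borel"
  proof (cases "Inf ?S \<in> ?S")
    case True
    have "?S = {Inf ?S..}"
    proof (intro set_eqI iffI)
      fix x assume "x \<in> ?S"
      then show "x \<in> {Inf ?S..}" unfolding atLeast_iff by (rule Inf_lower)
    next
      fix x assume "x \<in> {Inf ?S..}"
      then show "x \<in> ?S" using up[OF True] by simp
    qed
    then show ?thesis by (metis borel_closed closed_atLeast)
  next
    case False
    have "?S = {Inf ?S<..}"
    proof (intro set_eqI iffI)
      fix x assume x: "x \<in> ?S"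
      with False have "x \<noteq> Inf ?S" by metis
      with Inf_lower[OF x] show "x \<in> {Inf ?S<..}" by (simp only: greaterThan_iff less_le) (metis)
    next
      fix x assume "x \<in> {Inf ?S<..}"
      then obtain z where "z \<in> ?S" "z < x" by (auto simp: Inf_less_iff)
      then show "x \<in> ?S" using up less_imp_le by blast
    qed
    then show ?thesis by (metis borel_open open_greaterThan)
  qed
qed

section \<open>Left continuity and the Galois connection for the generalized inverse\<close>

lemma Pbar_mono: "\<Phi> \<in> Pbar \<Longrightarrow> mono \<Phi>"
  by (simp add: Pbar_def)

lemma Pbar_zero: "\<Phi> \<in> Pbar \<Longrightarrow> \<Phi> 0 = 0"
  by (simp add: Pbar_def)

lemma Pbar_above_b:
  assumes "\<Phi> \<in> Pbar" "b_of \<Phi> < t"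
  shows "\<Phi> t = top"
proof -
  obtain s where "\<Phi> s = top" "s < t"
    using assms(2) by (auto simp: b_of_def Inf_less_iff)
  then show ?thesis
    using monoD[OF Pbar_mono[OF assms(1)], of s t] by (simp add: top_unique)
qed

lemma Pbar_top:
  assumes "\<Phi> \<in> Pbar"
  shows "\<Phi> top = top"
proof (cases "b_of \<Phi> = top")
  case True then show ?thesis using assms by (simp add: Pbar_def)
next
  case False then show ?thesis by (intro Pbar_above_b[OF assms]) (simp add: less_top)
qed

text \<open>\<open>Pbar\<close> spreads left continuity over three clauses: below
  \<open>b_of \<Phi>\<close>, at a finite \<open>b_of \<Phi>\<close>, and at infinity. Here they are
  joined.\<close>

lemma Pbar_left_limit:
  assumes P: "\<Phi> \<in> Pbar" and t: "0 < t" "t \<le> b_of \<Phi>"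
  shows "(\<Phi> \<longlongrightarrow> \<Phi> t) (at_left t)"
proof (cases "t < b_of \<Phi>")
  case True then show ?thesis using P t by (auto simp: Pbar_def)
next
  case False
  then have "t = b_of \<Phi>" using t by auto
  then show ?thesis using P
    by (cases "b_of \<Phi> = top") (auto simp: Pbar_def less_top)
qed

text \<open>Left continuity, including at \<open>b(\<Phi>)\<close> and at \<open>\<infinity>\<close>.\<close>

lemma Pbar_lsc:
  assumes P: "\<Phi> \<in> Pbar" and le: "\<And>s. s < t \<Longrightarrow> \<Phi> s \<le> v"
  shows "\<Phi> t \<le> v"
proof -
  consider "t = 0" | "0 < t" "t \<le> b_of \<Phi>" | "b_of \<Phi> < t"
    by (metis not_gr_zero not_le)
  then show ?thesis
  proof cases
    case 1 then show ?thesis using Pbar_zero[OF P] by simp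
  next
    case 2
    have "at_left t \<noteq> bot"
      using eventually_at_left[OF 2(1), of "\<lambda>_. False"] dense by (auto simp: eventually_False)
    moreover have "\<forall>\<^sub>F s in at_left t. \<Phi> s \<le> v"
      using le by (auto simp: eventually_at_filter)
    ultimately show ?thesis
      using tendsto_upperbound[OF Pbar_left_limit[OF P 2]] by blast
  next
    case 3
    \<comment> \<open>Beyond \<open>b_of \<Phi>\<close> there is a smaller point where
      \<open>\<Phi>\<close> is already infinite, which forces \<open>v\<close> to be
      infinite.\<close>
    then obtain s where "b_of \<Phi> < s" "s < t" using dense by blast
    then have "top \<le> v" using Pbar_above_b[OF P, of s] le[of s] by simp
    then show ?thesis by (simp add: top_unique)
  qed
qed

text \<open>Every point strictly below the infimum satisfies \<open>\<Phi> s \<le> v\<close>, and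
  left continuity carries this to the infimum itself; the other direction is monotonicity.\<close>

lemma le_gen_inv_iff:
  assumes P: "\<Phi> \<in> Pbar" and v: "v < top"
  shows "t \<le> gen_inv \<Phi> v \<longleftrightarrow> \<Phi> t \<le> v"
proof
  assume t: "t \<le> gen_inv \<Phi> v"
  show "\<Phi> t \<le> v"
  proof (rule Pbar_lsc[OF P])
    fix s assume "s < t"
    then have "s < Inf {t. v < \<Phi> t}" using t less_imp_neq[OF v] by (auto simp: gen_inv_def)
    then show "\<Phi> s \<le> v" by (metis Inf_lower mem_Collect_eq not_le)
  qed
next
  assume "\<Phi> t \<le> v"
  then have "t \<le> s" if "v < \<Phi> s" for s
    using that monoD[OF Pbar_mono[OF P], of s t] by (meson less_le_trans linear not_le)
  then show "t \<le> gen_inv \<Phi> v"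
    using v by (auto simp: gen_inv_def intro: Inf_greatest)
qed

text \<open>A bound \<open>v\<close> at all finite arguments would pass to infinity by left
  continuity, where the value is \<open>top\<close>.\<close>

lemma Pbar_unbounded:
  assumes P: "\<Phi> \<in> Pbar" and v: "v < top"
  obtains s where "s < top" "v < \<Phi> s"
proof -
  have "\<not> \<Phi> top \<le> v" using Pbar_top[OF P] v by (simp add: not_le)
  then obtain s where "s < top" "\<not> \<Phi> s \<le> v" using Pbar_lsc[OF P, of top v] by blast
  then show thesis using that by (simp add: not_le)
qed

section \<open>Superlinearity in place of convexity\<close>

text \<open>Convexity between 0 and \<open>\<alpha> t\<close>, with \<open>Y 0 = 0\<close>, gives
  \<open>\<alpha> Y(t) \<le> Y(\<alpha> t)\<close> as long as \<open>\<alpha> t < b_of Y\<close>.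
  The factor 2 settles the other case: \<open>Y\<close> may be finite at \<open>b_of Y\<close>, but
  \<open>2 \<alpha> t\<close> lies strictly beyond it.\<close>

lemma young_superlinear:
  assumes Y: "young Y" and \<alpha>: "1 \<le> \<alpha>"
  shows "ennreal \<alpha> * Y t \<le> Y (ennreal (2 * \<alpha>) * t)"
proof -
  have P: "Y \<in> Pbar" using Y by (simp add: young_def)
  have b: "0 < b_of Y" using P by (simp add: Pbar_def)
  show ?thesis
  proof (cases "ennreal \<alpha> * t < b_of Y")
    case True
    have "Y (ennreal (1/\<alpha>) * (ennreal \<alpha> * t) + ennreal (1 - 1/\<alpha>) * 0)
        \<le> ennreal (1/\<alpha>) * Y (ennreal \<alpha> * t) + ennreal (1 - 1/\<alpha>) * Y 0"
      using Y True b \<alpha> unfolding young_def by (auto simp del: mult_zero_right)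
    also have "ennreal (1/\<alpha>) * (ennreal \<alpha> * t) + ennreal (1 - 1/\<alpha>) * 0 = t"
      using \<alpha> by (simp add: mult.assoc[symmetric] ennreal_mult[symmetric])
    finally have "Y t \<le> ennreal (1/\<alpha>) * Y (ennreal \<alpha> * t)"
      using Pbar_zero[OF P] by simp
    then have "ennreal \<alpha> * Y t \<le> ennreal \<alpha> * (ennreal (1/\<alpha>) * Y (ennreal \<alpha> * t))"
      by (rule mult_left_mono) simp
    also have "\<dots> = Y (ennreal \<alpha> * t)"
      using \<alpha> by (simp add: mult.assoc[symmetric] ennreal_mult[symmetric])
    also have "\<dots> \<le> Y (ennreal (2 * \<alpha>) * t)"
      using \<alpha> by (intro monoD[OF Pbar_mono[OF P]] mult_right_mono ennreal_leI) auto
    finally show ?thesis .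
  next
    case False
    then have le: "b_of Y \<le> ennreal \<alpha> * t" by simp
    have "Y (ennreal (2 * \<alpha>) * t) = top"
    proof (cases "t = top")
      case True then show ?thesis using \<alpha> Pbar_top[OF P] by (simp add: ennreal_mult_top)
    next
      case False
      then obtain s where s: "t = ennreal s" "0 \<le> s" by (cases t) auto
      have "0 < s" using b le s \<alpha> by (cases "s = 0") auto
      have "b_of Y < ennreal (2 * \<alpha>) * t"
        by (rule le_less_trans[OF le])
          (use s \<open>0 < s\<close> \<alpha> in \<open>auto simp: ennreal_mult[symmetric] intro!: ennreal_lessI\<close>)
      then show ?thesis by (rule Pbar_above_b[OF P])
    qed
    then show ?thesis by simp
  qed
qed

lemma PbarY_superlinear:
  assumes "\<Phi> \<in> PbarY"
  obtains K :: real where "1 \<le> K" "\<And>\<alpha> t. 1 \<le> \<alpha> \<Longrightarrow> ennreal \<alpha> * \<Phi> t \<le> \<Phi> (ennreal (K * \<alpha>) * t)"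
proof -
  obtain Y C where P: "\<Phi> \<in> Pbar" and Y: "young Y" and C: "C > 0"
    and eq: "\<And>t. \<Phi> (t / ennreal C) \<le> Y t" "\<And>t. Y t \<le> \<Phi> (ennreal C * t)"
    using assms by (auto simp: PbarY_def equiv_fun_def)
  show thesis
  \<comment> \<open>A factor \<open>C\<close> is lost on the way to the Young function and again on
    the way back; 2 comes from \<open>young_superlinear\<close>. The maximum ensures
    \<open>1 \<le> K\<close>.\<close>
  proof (rule that[of "max 1 (2 * C * C)"])
    fix \<alpha> :: real and t assume \<alpha>: "1 \<le> \<alpha>"
    have "\<Phi> t \<le> Y (ennreal C * t)"
      using eq(1)[of "ennreal C * t"] C
      by (simp add: mult.commute[of "ennreal C"] ennreal_mult_divide_eq)
    then have "ennreal \<alpha> * \<Phi> t \<le> ennreal \<alpha> * Y (ennreal C * t)"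
      by (rule mult_left_mono) simp
    also have "\<dots> \<le> Y (ennreal (2 * \<alpha>) * (ennreal C * t))"
      by (rule young_superlinear[OF Y \<alpha>])
    also have "\<dots> \<le> \<Phi> (ennreal C * (ennreal (2 * \<alpha>) * (ennreal C * t)))"
      by (rule eq)
    also have "ennreal C * (ennreal (2 * \<alpha>) * (ennreal C * t)) = ennreal (2 * C * C * \<alpha>) * t"
      using C \<alpha> by (simp add: ennreal_mult ac_simps)
    also have "\<Phi> \<dots> \<le> \<Phi> (ennreal (max 1 (2 * C * C) * \<alpha>) * t)"
      using \<alpha> by (intro monoD[OF Pbar_mono[OF P]] mult_right_mono ennreal_leI) auto
    finally show "ennreal \<alpha> * \<Phi> t \<le> \<Phi> (ennreal (max 1 (2 * C * C) * \<alpha>) * t)" .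
  qed simp
qed

lemma le_divide_iff_ennreal:
  fixes a b c :: ennreal
  assumes "0 < b" "b < top"
  shows "a \<le> c / b \<longleftrightarrow> a * b \<le> c"
proof -
  obtain \<beta> where \<beta>: "b = ennreal \<beta>" "0 < \<beta>"
    using assms by (cases b) auto
  show ?thesis
    by (cases a; cases c)
      (use \<beta> in \<open>auto simp: divide_ennreal ennreal_mult[symmetric] pos_le_divide_eq ennreal_top_divide
         ennreal_top_mult top_unique ennreal_mult_eq_top_iff\<close>)
qed

lemma divide_le_iff_ennreal:
  fixes a b c :: ennreal
  assumes "0 < b" "b < top"
  shows "c / b \<le> a \<longleftrightarrow> c \<le> a * b"
proof -
  obtain \<beta> where \<beta>: "b = ennreal \<beta>" "0 < \<beta>"
    using assms by (cases b) auto
  show ?thesis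
    by (cases a; cases c)
      (use \<beta> in \<open>auto simp: divide_ennreal ennreal_mult[symmetric] pos_divide_le_eq ennreal_top_divide
         ennreal_top_mult top_unique ennreal_mult_eq_top_iff\<close>)
qed

section \<open>Jensen's inequality up to a constant\<close>

text \<open>Unlike convexity, superlinearity up to a factor is inherited by equivalent functions, so
  it can be required of \<open>\<Phi>\<close> itself.\<close>

locale growth_function =
  fixes \<Phi> :: "ennreal \<Rightarrow> ennreal" and K :: real
  assumes Pbar: "\<Phi> \<in> Pbar"
    and K: "1 \<le> K"
    and superlinear: "1 \<le> \<alpha> \<Longrightarrow> ennreal \<alpha> * \<Phi> t \<le> \<Phi> (ennreal (K * \<alpha>) * t)"
begin

lemmas mono = Pbar_mono[OF Pbar]
lemmas zero = Pbar_zero[OF Pbar]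
lemmas top = Pbar_top[OF Pbar]
lemmas lsc = Pbar_lsc[OF Pbar]
lemmas le_inv_iff = le_gen_inv_iff[OF Pbar]

lemma measurable_compose [measurable]: "g \<in> borel_measurable M \<Longrightarrow> (\<lambda>x. \<Phi> (g x)) \<in> borel_measurable M"
  by (rule measurable_compose[OF _ mono_ennreal_borel_measurable[OF mono]])

text \<open>Above \<open>K \<sigma>\<close>, superlinearity makes \<open>\<Phi> u / w\<close> grow at least like \<open>u / (K \<sigma>)\<close>. The intermediate
  value \<open>w\<close> avoids dividing by \<open>\<Phi> \<sigma>\<close>, which may be infinite.\<close>

lemma le_affine:
  assumes w: "0 < w" "w < \<Phi> (ennreal \<sigma>)"
  shows "u \<le> ennreal (K * \<sigma>) * (1 + \<Phi> u / w)"
proof -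
  have \<sigma>: "0 < \<sigma>"
    using w zero by (cases "0 < \<sigma>") (auto simp: ennreal_neg)
  have wt: "w < top" using w(2) top_greatest less_le_trans by blast
  show ?thesis
  proof (cases u)
    case (real \<tau>)
    show ?thesis
    proof (cases "\<tau> \<le> K * \<sigma>")
      case True
      then have "u \<le> ennreal (K * \<sigma>) * 1" using real by (simp add: ennreal_leI)
      also have "\<dots> \<le> ennreal (K * \<sigma>) * (1 + \<Phi> u / w)" by (intro mult_left_mono) auto
      finally show ?thesis .
    next
      case False
      define \<alpha> where "\<alpha> = \<tau> / (K * \<sigma>)"
      have \<alpha>: "1 \<le> \<alpha>" and \<tau>: "\<tau> = K * \<sigma> * \<alpha>" using False \<sigma> K by (auto simp: \<alpha>_def field_simps)
      have "ennreal \<alpha> * w \<le> ennreal \<alpha> * \<Phi> (ennreal \<sigma>)" using w by (intro mult_left_mono) auto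
      also have "\<dots> \<le> \<Phi> (ennreal (K * \<alpha>) * ennreal \<sigma>)" by (rule superlinear[OF \<alpha>])
      also have "ennreal (K * \<alpha>) * ennreal \<sigma> = u"
        using real \<tau> K \<alpha> \<sigma> by (simp add: ennreal_mult[symmetric] ac_simps)
      finally have "ennreal \<alpha> \<le> \<Phi> u / w" using w wt by (simp add: le_divide_iff_ennreal)
      then have "ennreal (K * \<sigma>) * ennreal \<alpha> \<le> ennreal (K * \<sigma>) * (1 + \<Phi> u / w)"
        by (intro mult_left_mono) (auto intro: add_increasing)
      then show ?thesis using real \<tau> K \<alpha> \<sigma> by (simp add: ennreal_mult[symmetric])
    qed
  next
    case top
    then show ?thesis using less_imp_neq[OF wt] \<sigma> K growth_function.top[OF growth_function_axioms]
      by (simp add: ennreal_top_divide ennreal_mult_top)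
  qed
qed

text \<open>Jensen's inequality \<open>\<Phi>(avg g / (2 K)) \<le> avg (\<Phi> \<circ> g)\<close>, stated without division.\<close>

lemma jensen:
  assumes g[measurable]: "g \<in> borel_measurable M" and E[measurable]: "E \<in> sets M"
    and fin: "emeasure M E < top"
    and s: "ennreal (2 * K) * s * emeasure M E \<le> (\<integral>\<^sup>+y\<in>E. g y \<partial>M)"
  shows "\<Phi> s * emeasure M E \<le> (\<integral>\<^sup>+y\<in>E. \<Phi> (g y) \<partial>M)"
proof (cases "emeasure M E = 0")
  case False
  then have pos: "0 < emeasure M E" by (simp add: zero_less_iff_neq_zero)
  let ?I = "\<integral>\<^sup>+y\<in>E. \<Phi> (g y) \<partial>M"
  \<comment> \<open>Left continuity reduces the claim to finite arguments below \<open>s\<close>,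
    for which \<open>le_affine\<close> is available.\<close>
  have "\<Phi> s \<le> ?I / emeasure M E"
  proof (rule lsc)
    fix s' assume "s' < s"
    then obtain \<sigma> where s': "s' = ennreal \<sigma>" "0 \<le> \<sigma>"
      by (cases s') auto
    show "\<Phi> s' \<le> ?I / emeasure M E"
    proof (rule ccontr)
      assume "\<not> ?thesis"
      then obtain w where w: "?I / emeasure M E < w" "w < \<Phi> (ennreal \<sigma>)"
        using dense s' not_le by metis
      have w0: "0 < w" using w(1) by (rule le_less_trans[rotated]) simp
      have wt: "w < top" using w(2) top_greatest less_le_trans by blast
      have \<sigma>: "0 < \<sigma>" using w(2) w0 zero s' by (cases "\<sigma> = 0") auto
      have Iw: "?I < w * emeasure M E"
        using w(1) pos fin by (simp add: divide_less_ennreal)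
      have "ennreal (2 * K) * ennreal \<sigma> * emeasure M E \<le> ennreal (2 * K) * s * emeasure M E"
        using \<open>s' < s\<close> s' by (intro mult_right_mono mult_left_mono) auto
      also have "\<dots> \<le> (\<integral>\<^sup>+y\<in>E. g y \<partial>M)" by (rule s)
      \<comment> \<open>Integrate the affine bound over \<open>E\<close>. Under the contradiction
        hypothesis the integral of \<open>\<Phi> (g y) / w\<close> is strictly below the measure of
        \<open>E\<close>, so the mean of \<open>g\<close> would be strictly below
        \<open>2 K \<sigma>\<close>.\<close>
      also have "\<dots> \<le> (\<integral>\<^sup>+y. ennreal (K * \<sigma>) * (indicator E y + \<Phi> (g y) * indicator E y / w) \<partial>M)"
        using le_affine[OF w0 w(2)] by (intro nn_integral_mono) (auto split: split_indicator)
      also have "\<dots> = ennreal (K * \<sigma>) * (emeasure M E + ?I / w)"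
        by (simp add: nn_integral_cmult nn_integral_add nn_integral_divide)
      also have "\<dots> < ennreal (K * \<sigma>) * (emeasure M E + emeasure M E)"
      proof (intro ennreal_mult_strict_left_mono)
        have "?I / w < emeasure M E"
          using w0 wt Iw by (simp add: divide_less_ennreal mult.commute)
        then show "emeasure M E + ?I / w < emeasure M E + emeasure M E"
          using fin by (simp add: ennreal_add_left_cancel_less)
      qed (use K \<sigma> in auto)
      also have "\<dots> = ennreal (2 * K) * ennreal \<sigma> * emeasure M E"
      proof -
        have eq: "ennreal (2 * K) * ennreal \<sigma> = ennreal (K * \<sigma>) * 2"
        proof -
          have "ennreal (2 * K) * ennreal \<sigma> = ennreal ((K * \<sigma>) * 2)"
            using K \<sigma> by (subst ennreal_mult[symmetric]) (auto simp: ac_simps)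
          then show ?thesis using K \<sigma> by (simp add: ennreal_mult'')
        qed
        show ?thesis unfolding eq by (simp only: mult.assoc mult_2)
      qed
      finally show False by simp
    qed
  qed
  then show ?thesis using pos fin by (simp add: le_divide_iff_ennreal)
qed simp

end

section \<open>Balls and Vitali's covering lemma\<close>

lemma emeasure_lebesgue_ball:
  fixes z :: "'a::euclidean_space"
  assumes "0 \<le> r"
  shows "emeasure lebesgue (ball z r) = ennreal (unit_ball_vol DIM('a) * r ^ DIM('a))"
  using emeasure_ball[OF assms, of z] by simp

lemma emeasure_lebesgue_ball_pos:
  fixes z :: "'a::euclidean_space"
  assumes "0 < r"
  shows "0 < emeasure lebesgue (ball z r)" "emeasure lebesgue (ball z r) < top"
  unfolding emeasure_lebesgue_ball[OF less_imp_le[OF assms]] using assms by auto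

text \<open>The indicator of the union is at most the sum of the indicators, and sum and integral
  may be exchanged. Writing sums as integrals over \<open>count_space I\<close> avoids an
  enumeration of \<open>I\<close>.\<close>

lemma emeasure_UN_countable_le:
  assumes X: "\<And>i. i \<in> I \<Longrightarrow> X i \<in> sets M" and I: "countable I"
  shows "emeasure M (\<Union>i\<in>I. X i) \<le> (\<integral>\<^sup>+i. emeasure M (X i) \<partial>count_space I)"
proof -
  have "(\<Union>i\<in>I. X i) \<in> sets M" using X I by auto
  then have "emeasure M (\<Union>i\<in>I. X i) = (\<integral>\<^sup>+x. indicator (\<Union>i\<in>I. X i) x \<partial>M)" by simp
  also have "\<dots> \<le> (\<integral>\<^sup>+x. (\<integral>\<^sup>+i. indicator (X i) x \<partial>count_space I) \<partial>M)"
  proof (rule nn_integral_mono)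
    fix x
    show "indicator (\<Union>i\<in>I. X i) x \<le> (\<integral>\<^sup>+i. indicator (X i) x \<partial>count_space I)"
    proof (cases "x \<in> (\<Union>i\<in>I. X i)")
      case True
      then obtain i where "i \<in> I" "x \<in> X i" by blast
      then show ?thesis
        using nn_integral_ge_point[of i I "\<lambda>i. indicator (X i) x"] True by simp
    qed simp
  qed
  also have "\<dots> = (\<integral>\<^sup>+i. (\<integral>\<^sup>+x. indicator (X i) x \<partial>M) \<partial>count_space I)"
    by (rule nn_integral_count_space_nn_integral[OF I]) (use X in simp)
  also have "\<dots> = (\<integral>\<^sup>+i. emeasure M (X i) \<partial>count_space I)"
    by (rule nn_integral_cong) (use X in simp)
  finally show ?thesis .
qed

text \<open>Vitali's lemma, which asks for bounded radii, selects countably many disjoint balls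
  whose fivefold enlargements cover the union. Enlarging costs \<open>5^n\<close> in measure, and by
  disjointness the integrals of \<open>h\<close> over the selected balls add up to at most the
  total.\<close>

lemma vitali_ball_estimate:
  fixes h :: "'a::euclidean_space \<Rightarrow> ennreal"
  assumes h[measurable]: "h \<in> borel_measurable lebesgue"
    and U: "\<And>z r. (z, r) \<in> U \<Longrightarrow> 0 < r \<and> v * emeasure lebesgue (ball z r) \<le> (\<integral>\<^sup>+y\<in>ball z r. h y \<partial>lebesgue)"
    and bound: "\<And>z r. (z, r) \<in> U \<Longrightarrow> r \<le> R"
  shows "v * emeasure lebesgue (\<Union>(z, r)\<in>U. ball z r) \<le> ennreal (5 ^ DIM('a)) * (\<integral>\<^sup>+y. h y \<partial>lebesgue)"
proof -
  obtain C where C: "countable C" "C \<subseteq> U"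
    "pairwise (\<lambda>i j. disjnt (ball (fst i) (snd i)) (ball (fst j) (snd j))) C"
    "(\<Union>(z, r)\<in>U. ball z r) \<subseteq> (\<Union>i\<in>C. ball (fst i) (5 * snd i))"
  proof (rule Vitali_covering_lemma_balls[where S = "\<Union>(z, r)\<in>U. ball z r" and K = U and a = fst and r = snd and B = R])
    show "(\<Union>(z, r)\<in>U. ball z r) \<subseteq> (\<Union>i\<in>U. ball (fst i) (snd i))" by force
    show "0 < snd i \<and> snd i \<le> R" if "i \<in> U" for i
      using U[of "fst i" "snd i"] bound[of "fst i" "snd i"] that by simp
  qed (blast intro: that)
  let ?B = "\<lambda>i. ball (fst i) (snd i)"
  have disj: "disjoint_family_on ?B C"
    using C(3) by (auto simp: disjoint_family_on_def pairwise_def disjnt_def)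
  have "v * emeasure lebesgue (\<Union>(z, r)\<in>U. ball z r) \<le> v * emeasure lebesgue (\<Union>i\<in>C. ball (fst i) (5 * snd i))"
    using C by (intro mult_left_mono emeasure_mono) auto
  also have "\<dots> \<le> v * (\<integral>\<^sup>+i. emeasure lebesgue (ball (fst i) (5 * snd i)) \<partial>count_space C)"
    using C by (intro mult_left_mono emeasure_UN_countable_le) auto
  also have "\<dots> = (\<integral>\<^sup>+i. v * emeasure lebesgue (ball (fst i) (5 * snd i)) \<partial>count_space C)"
    by (simp add: nn_integral_cmult)
  \<comment> \<open>As values of the measure \<open>density lebesgue h\<close>, the integrals over
    disjoint balls sum to the measure of their union.\<close>
  also have "\<dots> \<le> (\<integral>\<^sup>+i. ennreal (5 ^ DIM('a)) * emeasure (density lebesgue h) (?B i) \<partial>count_space C)"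
  proof (rule nn_integral_mono)
    fix i assume "i \<in> space (count_space C)"
    then have i: "i \<in> U" using C by auto
    then have r: "0 < snd i" using U[of "fst i" "snd i"] by simp
    have "v * emeasure lebesgue (ball (fst i) (5 * snd i))
        = ennreal (5 ^ DIM('a)) * (v * emeasure lebesgue (?B i))"
    proof -
      have "emeasure lebesgue (ball (fst i) (5 * snd i)) = ennreal (5 ^ DIM('a)) * emeasure lebesgue (?B i)"
        using r by (simp add: emeasure_ball power_mult_distrib ennreal_mult'[symmetric] mult.left_commute)
      then show ?thesis by (simp only: mult.left_commute)
    qed
    also have "\<dots> \<le> ennreal (5 ^ DIM('a)) * emeasure (density lebesgue h) (?B i)"
      using U[of "fst i" "snd i"] i by (intro mult_left_mono) (auto simp: emeasure_density)
    finally show "v * emeasure lebesgue (ball (fst i) (5 * snd i))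
      \<le> ennreal (5 ^ DIM('a)) * emeasure (density lebesgue h) (?B i)" .
  qed
  also have "\<dots> = ennreal (5 ^ DIM('a)) * (\<integral>\<^sup>+i. emeasure (density lebesgue h) (?B i) \<partial>count_space C)"
    by (rule nn_integral_cmult) simp
  also have "(\<integral>\<^sup>+i. emeasure (density lebesgue h) (?B i) \<partial>count_space C) = emeasure (density lebesgue h) (\<Union>i\<in>C. ?B i)"
    using C disj by (intro emeasure_UN_countable[symmetric]) auto
  also have "\<dots> \<le> emeasure (density lebesgue h) (space (density lebesgue h))"
    by (rule emeasure_space)
  also have "\<dots> = (\<integral>\<^sup>+y. h y \<partial>lebesgue)"
    by (simp add: emeasure_density)
  finally show ?thesis by (simp add: mult_left_mono)
qed

text \<open>The constant in the bounded case does not depend on \<open>R\<close>, so exhausting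
  \<open>U\<close> by the balls of radius at most \<open>n\<close> and letting \<open>n\<close> grow
  removes the bound.\<close>

lemma weak_type_balls:
  fixes h :: "'a::euclidean_space \<Rightarrow> ennreal"
  assumes h[measurable]: "h \<in> borel_measurable lebesgue"
    and U: "\<And>z r. (z, r) \<in> U \<Longrightarrow> 0 < r \<and> v * emeasure lebesgue (ball z r) \<le> (\<integral>\<^sup>+y\<in>ball z r. h y \<partial>lebesgue)"
  shows "v * emeasure lebesgue (\<Union>(z, r)\<in>U. ball z r) \<le> ennreal (5 ^ DIM('a)) * (\<integral>\<^sup>+y. h y \<partial>lebesgue)"
proof -
  define S where "S n = (\<Union>(z, r)\<in>{(z, r) \<in> U. r \<le> real n}. ball z r)" for n
  have "incseq S"
  proof (rule incseq_SucI)
    show "S n \<le> S (Suc n)" for n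
      unfolding S_def by (rule UN_mono) auto
  qed
  moreover have "open (S n)" for n unfolding S_def by (auto intro!: open_UN)
  then have "range S \<subseteq> sets lebesgue" by auto
  ultimately have "(SUP n. emeasure lebesgue (S n)) = emeasure lebesgue (\<Union>n. S n)"
    by (intro SUP_emeasure_incseq)
  moreover have "(\<Union>n. S n) = (\<Union>(z, r)\<in>U. ball z r)"
  proof (intro set_eqI iffI)
    fix x assume "x \<in> (\<Union>(z, r)\<in>U. ball z r)"
    then obtain z r where zr: "(z, r) \<in> U" "x \<in> ball z r" by blast
    obtain n where "r \<le> real n" using real_arch_simple by blast
    then have "x \<in> S n" unfolding S_def using zr by blast
    then show "x \<in> (\<Union>n. S n)" by blast
  qed (unfold S_def, blast)
  ultimately have "v * emeasure lebesgue (\<Union>(z, r)\<in>U. ball z r) = (SUP n. v * emeasure lebesgue (S n))"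
    by (simp only: SUP_mult_left_ennreal[symmetric])
  also have "\<dots> \<le> ennreal (5 ^ DIM('a)) * (\<integral>\<^sup>+y. h y \<partial>lebesgue)"
    unfolding S_def by (rule SUP_least, rule vitali_ball_estimate[OF h]) (use U in auto)
  finally show ?thesis .
qed

section \<open>Maximal functions and averages over balls\<close>

text \<open>The balls need only contain \<open>x\<close>, not be centred there, so the level set is
  the union of all open balls of weight above \<open>c\<close>. The general weight covers both
  maximal operators.\<close>

lemma open_level_set:
  fixes w :: "'a::euclidean_space \<Rightarrow> real \<Rightarrow> ennreal"
  shows "open {x. c < (SUP zr\<in>{(z, r). r > 0 \<and> x \<in> ball z r}. w (fst zr) (snd zr))}"
proof -
  have "{x. c < (SUP zr\<in>{(z, r). r > 0 \<and> x \<in> ball z r}. w (fst zr) (snd zr))}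
      = (\<Union>(z, r)\<in>{(z, r). r > 0 \<and> c < w z r}. ball z r)"
    by (force simp: less_SUP_iff)
  then show ?thesis by (auto intro!: open_UN)
qed

lemma frac_max_measurable [measurable]: "frac_max \<rho> f \<in> borel_measurable lebesgue"
  and HL_max_measurable [measurable]: "HL_max f \<in> borel_measurable lebesgue"
proof -
  have "{x. y < frac_max \<rho> f x} \<in> sets lebesgue" "{x. y < HL_max f x} \<in> sets lebesgue" for y
    using open_level_set[of y "\<lambda>z r. ennreal (\<rho> r) * ball_avg f z r"] open_level_set[of y "ball_avg f"]
    by (auto simp: frac_max_def HL_max_def)
  then show "frac_max \<rho> f \<in> borel_measurable lebesgue" "HL_max f \<in> borel_measurable lebesgue"
    by (auto intro!: borel_measurableI_greater)
qed

lemma ball_avg_le_HL_max: "0 < r \<Longrightarrow> x \<in> ball z r \<Longrightarrow> ball_avg f z r \<le> HL_max f x"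
  unfolding HL_max_def by (rule SUP_upper2[of "(z, r)"]) auto

lemma less_HL_maxE:
  assumes "c < HL_max f x"
  obtains z r where "0 < r" "x \<in> ball z r" "c < ball_avg f z r"
  using assms by (auto simp: HL_max_def less_SUP_iff)

lemma ball_avg_divide:
  assumes f: "f \<in> borel_measurable lebesgue" and c: "0 < c"
  shows "ball_avg (\<lambda>x. f x / c) z r = ball_avg f z r / ennreal c"
proof -
  have "(\<integral>\<^sup>+y\<in>ball z r. ennreal \<bar>f y / c\<bar> \<partial>lebesgue) = (\<integral>\<^sup>+y. (ennreal \<bar>f y\<bar> * indicator (ball z r) y) / ennreal c \<partial>lebesgue)"
    using c by (intro nn_integral_cong) (auto simp: divide_ennreal split: split_indicator)
  also have "\<dots> = (\<integral>\<^sup>+y\<in>ball z r. ennreal \<bar>f y\<bar> \<partial>lebesgue) / ennreal c"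
    by (intro nn_integral_divide borel_measurable_times_ennreal borel_measurable_indicator) (use f in auto)
  finally show ?thesis by (simp add: ball_avg_def divide_ennreal_def ac_simps)
qed

lemma HL_max_divide:
  assumes "f \<in> borel_measurable lebesgue" and "0 < c"
  shows "HL_max (\<lambda>x. f x / c) x = HL_max f x / ennreal c"
  unfolding HL_max_def by (simp add: ball_avg_divide[OF assms] SUP_divide_ennreal)

lemma le_ball_avg_iff:
  assumes "0 < r"
  shows "c \<le> ball_avg f z r \<longleftrightarrow> c * emeasure lebesgue (ball z r) \<le> (\<integral>\<^sup>+y\<in>ball z r. ennreal \<bar>f y\<bar> \<partial>lebesgue)"
  unfolding ball_avg_def
  by (rule le_divide_iff_ennreal) (intro emeasure_lebesgue_ball_pos assms)+

lemma ennreal_mult_divide_cancel: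
  assumes "0 < c"
  shows "ennreal c * (x / ennreal c) = x"
  using assms mult_divide_eq_ennreal[of "ennreal c" x]
  by (simp add: ennreal_times_divide mult.commute)

section \<open>Averages against the generalized inverse, and the weak type of the maximal
  operator\<close>

context growth_function
begin

text \<open>The measure of the ball is \<open>unit_ball_vol\<close> times \<open>r^n\<close>, so a
  factor \<open>\<beta>\<close> must be gained; superlinearity supplies it for
  \<open>K \<beta>\<close> in the argument. It applies to factors at least 1, hence the
  maximum.\<close>

lemma le_gen_inv_ball:
  fixes z :: "'a::euclidean_space"
  assumes r: "0 < r" and le1: "\<Phi> y * emeasure lebesgue (ball z r) \<le> 1"
  shows "y \<le> ennreal (K * max 1 (1 / unit_ball_vol DIM('a))) * gen_inv \<Phi> (ennreal (1 / r ^ DIM('a)))"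
proof -
  define \<beta> where "\<beta> = max 1 (1 / unit_ball_vol DIM('a))"
  have \<beta>: "1 \<le> \<beta>" "1 \<le> \<beta> * unit_ball_vol DIM('a)"
    using less_imp_neq[OF unit_ball_vol_pos[of "real DIM('a)"]] by (auto simp: \<beta>_def max_def field_simps)
  define t where "t = y / ennreal (K * \<beta>)"
  have y: "y = ennreal (K * \<beta>) * t"
    using K \<beta> by (simp add: t_def ennreal_mult_divide_cancel)
  let ?b = "emeasure lebesgue (ball z r)"
  have "ennreal (r ^ DIM('a)) \<le> ennreal \<beta> * ?b"
    unfolding emeasure_lebesgue_ball[OF less_imp_le[OF r]]
    using r \<beta> mult_right_mono[OF \<beta>(2), of "r ^ DIM('a)"]
    by (auto simp: ennreal_mult'[symmetric] mult.assoc intro!: ennreal_leI)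
  then have "\<Phi> t * ennreal (r ^ DIM('a)) \<le> \<Phi> t * (ennreal \<beta> * ?b)"
    by (rule mult_left_mono) simp
  also have "\<dots> = (ennreal \<beta> * \<Phi> t) * ?b" by (simp only: ac_simps)
  also have "\<dots> \<le> \<Phi> y * ?b"
    unfolding y by (intro mult_right_mono superlinear \<beta>) simp
  also note le1
  finally have "\<Phi> t \<le> 1 / ennreal (r ^ DIM('a))"
    using r by (subst le_divide_iff_ennreal) auto
  then have "\<Phi> t \<le> ennreal (1 / r ^ DIM('a))"
    using r divide_ennreal[of 1 "r ^ DIM('a)"] by simp
  then show ?thesis
    unfolding y \<beta>_def[symmetric] by (intro mult_left_mono) (simp_all add: le_inv_iff)
qed

text \<open>The reverse passage, from the inverse to a modular bound on a ball; it will show that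
  suitable multiples of indicators of balls have modular at most 1.\<close>

lemma ball_le_of_le_gen_inv:
  fixes z :: "'a::euclidean_space"
  assumes r: "0 < r" and s: "s \<le> gen_inv \<Phi> (ennreal (1 / r ^ DIM('a)))"
  shows "\<Phi> (s / ennreal (K * max 1 (unit_ball_vol DIM('a)))) * emeasure lebesgue (ball z r) \<le> 1"
proof -
  define \<kappa> where "\<kappa> = max 1 (unit_ball_vol DIM('a))"
  have \<kappa>: "1 \<le> \<kappa>" "unit_ball_vol DIM('a) \<le> \<kappa>" by (auto simp: \<kappa>_def)
  define t where "t = s / ennreal (K * \<kappa>)"
  have st: "s = ennreal (K * \<kappa>) * t"
    using K \<kappa> by (simp add: t_def ennreal_mult_divide_cancel)
  have "emeasure lebesgue (ball z r) \<le> ennreal \<kappa> * ennreal (r ^ DIM('a))"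
    unfolding emeasure_lebesgue_ball[OF less_imp_le[OF r]]
    using r \<kappa> by (auto simp: ennreal_mult'[symmetric] intro!: ennreal_leI mult_right_mono)
  then have "\<Phi> t * emeasure lebesgue (ball z r) \<le> \<Phi> t * (ennreal \<kappa> * ennreal (r ^ DIM('a)))"
    by (rule mult_left_mono) simp
  also have "\<dots> = (ennreal \<kappa> * \<Phi> t) * ennreal (r ^ DIM('a))" by (simp only: ac_simps)
  also have "\<dots> \<le> \<Phi> s * ennreal (r ^ DIM('a))"
    unfolding st by (intro mult_right_mono superlinear \<kappa>) simp
  also have "\<dots> \<le> ennreal (1 / r ^ DIM('a)) * ennreal (r ^ DIM('a))"
    using s by (intro mult_right_mono) (simp_all add: le_inv_iff)
  also have "\<dots> = 1" using r by (simp add: ennreal_mult[symmetric])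
  finally show ?thesis by (simp add: t_def \<kappa>_def)
qed

text \<open>Jensen bounds \<open>\<Phi>\<close> of the average over \<open>2 K\<close>, times the
  measure of the ball, by the modular, hence by 1. The resulting bound depends on the radius alone,
  which is what large balls require.\<close>

lemma ball_avg_le_gen_inv:
  fixes f :: "'a::euclidean_space \<Rightarrow> real"
  defines "C \<equiv> 2 * K * (K * max 1 (1 / unit_ball_vol DIM('a)))"
  assumes f[measurable]: "f \<in> borel_measurable lebesgue"
    and int: "(\<integral>\<^sup>+y. \<Phi> (ennreal \<bar>f y\<bar>) \<partial>lebesgue) \<le> 1" and r: "0 < r"
  shows "ball_avg f z r \<le> ennreal C * gen_inv \<Phi> (ennreal (1 / r ^ DIM('a)))"
proof -
  let ?B = "ball z r"
  define s where "s = ball_avg f z r / ennreal (2 * K)"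
  have avg: "ball_avg f z r = ennreal (2 * K) * s"
    using K by (simp add: s_def ennreal_mult_divide_cancel)
  have "\<Phi> s * emeasure lebesgue ?B \<le> (\<integral>\<^sup>+y\<in>?B. \<Phi> (ennreal \<bar>f y\<bar>) \<partial>lebesgue)"
    using emeasure_lebesgue_ball_pos[OF r, of z] le_ball_avg_iff[OF r, of "ennreal (2 * K) * s" f z] avg
    by (intro jensen) auto
  also have "\<dots> \<le> (\<integral>\<^sup>+y. \<Phi> (ennreal \<bar>f y\<bar>) \<partial>lebesgue)"
    by (intro nn_integral_mono) (auto split: split_indicator)
  also note int
  finally have "s \<le> ennreal (K * max 1 (1 / unit_ball_vol DIM('a))) * gen_inv \<Phi> (ennreal (1 / r ^ DIM('a)))"
    by (rule le_gen_inv_ball[OF r])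
  then have "ball_avg f z r \<le> ennreal (2 * K) *
      (ennreal (K * max 1 (1 / unit_ball_vol DIM('a))) * gen_inv \<Phi> (ennreal (1 / r ^ DIM('a))))"
    unfolding avg by (rule mult_left_mono) simp
  also have "\<dots> = ennreal C * gen_inv \<Phi> (ennreal (1 / r ^ DIM('a)))"
    unfolding C_def mult.assoc[symmetric] using K by (subst ennreal_mult'[symmetric]) (auto simp: mult.assoc)
  finally show ?thesis .
qed

text \<open>Each point of the level set lies in a ball on which \<open>\<Phi> |f|\<close> has mean
  at least \<open>5^n v\<close>, and the factor \<open>5^n\<close> cancels the one from Vitali's
  lemma. In \<open>D\<close>, \<open>2 K\<close> pays for Jensen and \<open>K 5^n\<close> for
  superlinearity; the remaining 2 gives the strict inequality needed to pick a ball from the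
  supremum.\<close>

lemma HL_max_weak_modular:
  fixes f :: "'a::euclidean_space \<Rightarrow> real"
  defines "D \<equiv> 4 * K * (K * 5 ^ DIM('a))"
  assumes f[measurable]: "f \<in> borel_measurable lebesgue"
    and int: "(\<integral>\<^sup>+y. \<Phi> (ennreal \<bar>f y\<bar>) \<partial>lebesgue) \<le> 1" and v: "0 < v"
  shows "ennreal v * emeasure lebesgue {x. ennreal v \<le> \<Phi> (HL_max f x / ennreal D)} \<le> 1"
proof -
  define \<alpha> :: real where "\<alpha> = 5 ^ DIM('a)"
  have \<alpha>: "1 \<le> \<alpha>" by (simp add: \<alpha>_def)
  have D: "D = 4 * K * (K * \<alpha>)" "0 < D" using K \<alpha> by (auto simp: D_def \<alpha>_def)
  define U where "U = {(z :: 'a, r). 0 < r \<and> ennreal (\<alpha> * v) * emeasure lebesgue (ball z r)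
    \<le> (\<integral>\<^sup>+y\<in>ball z r. \<Phi> (ennreal \<bar>f y\<bar>) \<partial>lebesgue)}"
  have sub: "{x. ennreal v \<le> \<Phi> (HL_max f x / ennreal D)} \<subseteq> (\<Union>(z, r)\<in>U. ball z r)"
  proof
    fix x assume "x \<in> {x. ennreal v \<le> \<Phi> (HL_max f x / ennreal D)}"
    then have x: "ennreal v \<le> \<Phi> (HL_max f x / ennreal D)" by simp
    obtain s where s: "ennreal (\<alpha> * v) \<le> \<Phi> s" "ennreal (2 * K) * s < HL_max f x"
    proof (cases "HL_max f x")
      case (real h)
      have h: "0 < h" using x real v zero by (cases "h = 0") auto
      have "ennreal (\<alpha> * v) \<le> ennreal \<alpha> * \<Phi> (HL_max f x / ennreal D)"
        using x v \<alpha> by (simp add: ennreal_mult mult_left_mono)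
      also have "\<dots> \<le> \<Phi> (ennreal (K * \<alpha>) * (HL_max f x / ennreal D))"
        by (rule superlinear[OF \<alpha>])
      finally show thesis
      proof (rule that)
        show "ennreal (2 * K) * (ennreal (K * \<alpha>) * (HL_max f x / ennreal D)) < HL_max f x"
          using real h K \<alpha> D(2) unfolding D(1)
          by (simp add: divide_ennreal ennreal_mult[symmetric] ennreal_less_iff)
      qed
    next
      case top
      \<comment> \<open>An infinite maximal function exceeds every finite multiple of
        \<open>s\<close>, so any finite \<open>s\<close> with a large enough value will do.\<close>
      obtain s where "s < top" "ennreal (\<alpha> * v) < \<Phi> s"
        using Pbar_unbounded[OF Pbar, of "ennreal (\<alpha> * v)"] by auto
      with top show thesis by (intro that[of s]) (auto simp: ennreal_mult_less_top)
    qed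
    obtain z r where zr: "0 < r" "x \<in> ball z r" "ennreal (2 * K) * s < ball_avg f z r"
      using less_HL_maxE[OF s(2)] by blast
    have "ennreal (\<alpha> * v) * emeasure lebesgue (ball z r) \<le> \<Phi> s * emeasure lebesgue (ball z r)"
      by (intro mult_right_mono s) simp
    also have "\<dots> \<le> (\<integral>\<^sup>+y\<in>ball z r. \<Phi> (ennreal \<bar>f y\<bar>) \<partial>lebesgue)"
      using zr emeasure_lebesgue_ball_pos[OF zr(1)] le_ball_avg_iff[OF zr(1), of "ennreal (2 * K) * s" f z]
      by (intro jensen) auto
    finally have "(z, r) \<in> U" using zr by (simp add: U_def)
    then show "x \<in> (\<Union>(z, r)\<in>U. ball z r)" using zr by blast
  qed
  have "open (\<Union>(z, r)\<in>U. ball z r)" by (auto intro!: open_UN)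
  then have "(\<Union>(z, r)\<in>U. ball z r) \<in> sets lebesgue" by auto
  then have "ennreal (\<alpha> * v) * emeasure lebesgue {x. ennreal v \<le> \<Phi> (HL_max f x / ennreal D)}
      \<le> ennreal (\<alpha> * v) * emeasure lebesgue (\<Union>(z, r)\<in>U. ball z r)"
    by (intro mult_left_mono emeasure_mono[OF sub]) auto
  also have "\<dots> \<le> ennreal \<alpha> * (\<integral>\<^sup>+y. \<Phi> (ennreal \<bar>f y\<bar>) \<partial>lebesgue)"
    unfolding \<alpha>_def by (rule weak_type_balls) (auto simp: U_def \<alpha>_def)
  also have "\<dots> \<le> ennreal \<alpha> * 1" by (intro mult_left_mono int) simp
  finally have "ennreal \<alpha> * (ennreal v * emeasure lebesgue {x. ennreal v \<le> \<Phi> (HL_max f x / ennreal D)})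
      \<le> ennreal \<alpha> * 1"
    unfolding ennreal_mult[OF order_trans[OF zero_le_one \<alpha>] less_imp_le[OF v]] mult.assoc .
  then show ?thesis
    by (rule ennreal_mult_le_mult_iff[THEN iffD1, rotated 2]) (use \<alpha> in auto)
qed

end

section \<open>The strong type of the maximal operator\<close>

text \<open>The part of \<open>f\<close> below \<open>\<tau>\<close> contributes at most \<open>\<tau>\<close> to every average, so only the part above \<open>\<tau>\<close> counts.\<close>

lemma HL_max_level_estimate:
  fixes f :: "'a::euclidean_space \<Rightarrow> real"
  assumes f[measurable]: "f \<in> borel_measurable lebesgue" and \<tau>: "0 < \<tau>"
  shows "ennreal \<tau> * emeasure lebesgue {x. ennreal (2 * \<tau>) < HL_max f x}
    \<le> ennreal (5 ^ DIM('a)) * (\<integral>\<^sup>+y. ennreal \<bar>f y\<bar> * indicator {y. \<tau> < \<bar>f y\<bar>} y \<partial>lebesgue)"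
proof -
  let ?h = "\<lambda>y. ennreal \<bar>f y\<bar> * indicator {y. \<tau> < \<bar>f y\<bar>} y"
  define U where "U = {(z :: 'a, r). 0 < r \<and> ennreal (2 * \<tau>) < ball_avg f z r}"
  have eq: "{x. ennreal (2 * \<tau>) < HL_max f x} = (\<Union>(z, r)\<in>U. ball z r)"
    by (force simp: U_def HL_max_def less_SUP_iff)
  have [measurable]: "{y. \<tau> < \<bar>f y\<bar>} \<in> sets lebesgue"
    using borel_measurable_less[OF borel_measurable_const borel_measurable_abs[OF f], of \<tau>] by simp
  have h: "?h \<in> borel_measurable lebesgue" by measurable
  show ?thesis
    unfolding eq
  proof (rule weak_type_balls[OF h])
    fix z :: 'a and r assume "(z, r) \<in> U"
    then have r: "0 < r" and avg: "ennreal (2 * \<tau>) \<le> ball_avg f z r" by (auto simp: U_def)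
    let ?b = "emeasure lebesgue (ball z r)"
    have "ennreal \<tau> * ?b + ennreal \<tau> * ?b = ennreal (2 * \<tau>) * ?b"
      using \<tau> by (simp only: distrib_right[symmetric] ennreal_plus[symmetric] less_imp_le mult_2)
    also have "\<dots> \<le> (\<integral>\<^sup>+y\<in>ball z r. ennreal \<bar>f y\<bar> \<partial>lebesgue)"
      using avg le_ball_avg_iff[OF r] by blast
    also have "\<dots> \<le> (\<integral>\<^sup>+y. ennreal \<tau> * indicator (ball z r) y + ?h y * indicator (ball z r) y \<partial>lebesgue)"
      by (intro nn_integral_mono) (auto split: split_indicator intro!: ennreal_leI)
    also have "\<dots> = ennreal \<tau> * ?b + (\<integral>\<^sup>+y\<in>ball z r. ?h y \<partial>lebesgue)"
      by (subst nn_integral_add)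
        (auto simp: nn_integral_cmult_indicator
          intro!: borel_measurable_times_ennreal borel_measurable_indicator)
    finally have "ennreal \<tau> * ?b \<le> (\<integral>\<^sup>+y\<in>ball z r. ?h y \<partial>lebesgue)"
      using emeasure_lebesgue_ball_pos(2)[OF r, of z]
      by (subst (asm) ennreal_add_left_cancel_le) (auto simp: ennreal_mult_eq_top_iff)
    with r show "0 < r \<and> ennreal \<tau> * ?b \<le> (\<integral>\<^sup>+y\<in>ball z r. ?h y \<partial>lebesgue)" by blast
  qed
qed

text \<open>Rounding the logarithm up and subtracting 1 makes the lower bound strict, as the strict
  level sets below require.\<close>

lemma powr_bracket:
  fixes k y :: real
  assumes "1 < k" "0 < y"
  obtains j :: int where "k powr j < y" "y \<le> k powr (j + 1)"
proof (rule that[of "\<lceil>log k y\<rceil> - 1"])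
  have "real_of_int (\<lceil>log k y\<rceil> - 1) < log k y" by linarith
  then show "k powr (\<lceil>log k y\<rceil> - 1) < y" using assms by (simp add: less_log_iff)
  have "log k y \<le> real_of_int (\<lceil>log k y\<rceil> - 1 + 1)" by linarith
  then show "y \<le> k powr real_of_int (\<lceil>log k y\<rceil> - 1 + 1)" using assms by (simp only: log_le_iff)
qed

text \<open>The terms decay like \<open>2\<^sup>-\<^sup>l\<close> when going down \<open>l\<close> levels from the largest \<open>k\<^sup>j\<close> below \<open>y\<close>.\<close>

lemma dyadic_sum_le:
  fixes F :: "ennreal \<Rightarrow> ennreal"
  assumes F: "mono F" "\<And>t. ennreal (2 * k) * F t \<le> F (ennreal k * t)" and k: "1 < k" and y: "0 < y"
  shows "(\<integral>\<^sup>+j. F (ennreal (k powr j)) * ennreal (y / k powr j) * indicator {j :: int. k powr j < y} j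
      \<partial>count_space (UNIV :: int set)) \<le> ennreal (2 * k) * F (ennreal y)"
proof -
  obtain i :: int where i: "k powr i < y" "y \<le> k powr (i + 1)"
    using powr_bracket[OF k y] by blast
  have set_eq: "{j :: int. k powr j < y} = {..i}"
  proof (intro set_eqI iffI)
    fix j :: int assume "j \<in> {j. k powr j < y}"
    then have "k powr j < k powr (i + 1)" using i by auto
    then show "j \<in> {..i}" using k by simp
  next
    fix j :: int assume "j \<in> {..i}"
    then have "k powr j \<le> k powr i" using k by simp
    then show "j \<in> {j. k powr j < y}" using i by auto
  qed
  have decay: "F (ennreal (k powr (i - int l))) * ennreal ((2 * k) ^ l) \<le> F (ennreal y)" for l
  proof (induction l)
    case 0
    then show ?case using i by (auto intro!: monoD[OF F(1)] ennreal_leI)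
  next
    case (Suc l)
    have "F (ennreal (k powr (i - int (Suc l)))) * ennreal ((2 * k) ^ Suc l)
        = (ennreal (2 * k) * F (ennreal (k powr (i - int (Suc l))))) * ennreal ((2 * k) ^ l)"
      using k by (simp add: ennreal_mult'' mult.assoc mult.left_commute mult.commute)
    also have "\<dots> \<le> F (ennreal k * ennreal (k powr (i - int (Suc l)))) * ennreal ((2 * k) ^ l)"
      by (intro mult_right_mono F) simp
    also have "ennreal k * ennreal (k powr (i - int (Suc l))) = ennreal (k powr (i - int l))"
    proof -
      have e: "real_of_int (i - int l) = 1 + real_of_int (i - int (Suc l))" by simp
      have "k * k powr real_of_int (i - int (Suc l)) = k powr real_of_int (i - int l)"
        unfolding e powr_add using k by simp
      then show ?thesis using k by (simp add: ennreal_mult[symmetric])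
    qed
    finally show ?case using Suc.IH by (rule order_trans)
  qed
  have "(\<integral>\<^sup>+j. F (ennreal (k powr j)) * ennreal (y / k powr j) * indicator {j :: int. k powr j < y} j
      \<partial>count_space (UNIV :: int set))
    = (\<integral>\<^sup>+j. F (ennreal (k powr j)) * ennreal (y / k powr j) \<partial>count_space {..i})"
    unfolding set_eq by (rule nn_integral_count_space_indicator[symmetric]) simp
  also have "\<dots> = (\<integral>\<^sup>+l. F (ennreal (k powr (i - int l))) * ennreal (y / k powr (i - int l)) \<partial>count_space UNIV)"
  proof (rule nn_integral_bij_count_space[symmetric, where g = "\<lambda>l. i - int l"])
    show "bij_betw (\<lambda>l. i - int l) UNIV {..i}"
      by (rule bij_betwI[where g = "\<lambda>j. nat (i - j)"]) auto
  qed
  also have "\<dots> = (\<Sum>l. F (ennreal (k powr (i - int l))) * ennreal (y / k powr (i - int l)))"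
    by (rule nn_integral_count_space_nat)
  \<comment> \<open>The weight \<open>y / k^(i-l)\<close> is at most \<open>k^(l+1)\<close>; against
    the decay \<open>(2k)^(-l)\<close> this leaves \<open>k 2^(-l)\<close>, with sum
    \<open>2 k\<close>.\<close>
  also have "\<dots> \<le> (\<Sum>l. F (ennreal y) * ennreal (k * (1 / 2) ^ l))"
  proof (intro suminf_le summableI)
    fix l
    have "y / k powr (i - int l) \<le> k powr (i + 1) / k powr (i - int l)"
      using i k by (intro divide_right_mono) auto
    also have "\<dots> = k powr (1 + l)"
      by (simp add: powr_diff[symmetric])
    also have "\<dots> = (2 * k) ^ l * (k * (1 / 2) ^ l)"
      using k by (simp add: powr_add powr_realpow power_mult_distrib field_simps)
    finally have "F (ennreal (k powr (i - int l))) * ennreal (y / k powr (i - int l))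
        \<le> F (ennreal (k powr (i - int l))) * ennreal ((2 * k) ^ l * (k * (1 / 2) ^ l))"
      by (intro mult_left_mono ennreal_leI) auto
    also have "\<dots> = (F (ennreal (k powr (i - int l))) * ennreal ((2 * k) ^ l)) * ennreal (k * (1 / 2) ^ l)"
      using k by (subst ennreal_mult) (auto simp: mult.assoc)
    also have "\<dots> \<le> F (ennreal y) * ennreal (k * (1 / 2) ^ l)"
      by (intro mult_right_mono decay) simp
    finally show "F (ennreal (k powr (i - int l))) * ennreal (y / k powr (i - int l))
        \<le> F (ennreal y) * ennreal (k * (1 / 2) ^ l)" .
  qed
  also have "\<dots> = F (ennreal y) * (\<Sum>l. ennreal (k * (1 / 2) ^ l))" by (rule ennreal_suminf_cmult)
  also have "(\<Sum>l. ennreal (k * (1 / 2) ^ l)) = ennreal (k * 2)"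
    using k sums_mult[OF geometric_sums[of "1 / 2 :: real"], of k]
    by (intro suminf_ennreal_eq) auto
  finally show ?thesis by (simp add: mult.commute)
qed

context growth_function
begin

text \<open>The set where \<open>HL_max f\<close> is infinite lies in the weak type level set for
  every \<open>v\<close>, so its measure is at most \<open>1 / v\<close> for all \<open>v\<close>.
  The dyadic decomposition needs this, since an infinite value has no largest level below
  it.\<close>

lemma HL_max_AE_finite:
  fixes f :: "'a::euclidean_space \<Rightarrow> real"
  assumes f[measurable]: "f \<in> borel_measurable lebesgue"
    and int: "(\<integral>\<^sup>+y. \<Phi> (ennreal \<bar>f y\<bar>) \<partial>lebesgue) \<le> 1"
  shows "AE x in lebesgue. HL_max f x < top"
proof -
  let ?N = "{x. HL_max f x = top}"
  have meas: "?N \<in> sets lebesgue"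
    using borel_measurable_vimage[OF HL_max_measurable[of f], of top] by (simp add: vimage_def)
  have le: "ennreal v * emeasure lebesgue ?N \<le> 1" if v: "0 < v" for v
  proof -
    define D where "D = 4 * K * (K * 5 ^ DIM('a))"
    have "?N \<subseteq> {x. ennreal v \<le> \<Phi> (HL_max f x / ennreal D)}"
      by (auto simp: ennreal_top_divide top)
    moreover have "{x. ennreal v \<le> \<Phi> (HL_max f x / ennreal D)} \<in> sets lebesgue"
    proof -
      have "(\<lambda>x. \<Phi> (HL_max f x / ennreal D)) \<in> borel_measurable lebesgue" by measurable
      from borel_measurable_le[OF borel_measurable_const this, of "ennreal v"] show ?thesis by simp
    qed
    ultimately have "ennreal v * emeasure lebesgue ?N
        \<le> ennreal v * emeasure lebesgue {x. ennreal v \<le> \<Phi> (HL_max f x / ennreal D)}"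
      by (intro mult_left_mono emeasure_mono) auto
    also have "\<dots> \<le> 1" unfolding D_def by (rule HL_max_weak_modular[OF f int v])
    finally show ?thesis .
  qed
  have "emeasure lebesgue ?N = 0"
  proof (cases "emeasure lebesgue ?N")
    case (real e)
    then have "2 / e * e \<le> 1" if "0 < e"
      using that le[of "2 / e"] by (simp add: ennreal_mult[symmetric])
    then have "e = 0" using real by (cases "e = 0") auto
    then show ?thesis using real by simp
  next
    case top
    then show ?thesis using le[of 1] by (simp add: top_unique)
  qed
  with meas have "?N \<in> null_sets lebesgue" by blast
  then show ?thesis by (rule AE_I') (auto simp: not_less top_unique)
qed

text \<open>\<open>\<Phi> (HL_max f x / D)\<close> is bounded by a sum over the levels
  \<open>2 k^j < HL_max f x\<close>. The level estimate and an exchange of sum and integral turn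
  this into a sum over \<open>k^j < |f y|\<close>, which \<open>dyadic_sum_le\<close> evaluates. In
  \<open>D\<close>, the first 2 belongs to the levels, the first \<open>k\<close> to the bracket,
  and the rest absorbs the factor \<open>5^n 2 k\<close> by superlinearity.\<close>

lemma HL_max_strong_modular:
  fixes f :: "'a::euclidean_space \<Rightarrow> real" and k :: real
  defines "D \<equiv> 2 * k * (K * (5 ^ DIM('a) * (2 * k)))"
  assumes f[measurable]: "f \<in> borel_measurable lebesgue"
    and int: "(\<integral>\<^sup>+y. \<Phi> (ennreal \<bar>f y\<bar>) \<partial>lebesgue) \<le> 1"
    and k: "1 < k" and nabla: "\<And>t. ennreal (2 * k) * \<Phi> t \<le> \<Phi> (ennreal k * t)"
  shows "(\<integral>\<^sup>+x. \<Phi> (HL_max f x / ennreal D) \<partial>lebesgue) \<le> 1"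
proof -
  define \<alpha> where "\<alpha> = 5 ^ DIM('a) * (2 * k)"
  have \<alpha>: "1 \<le> \<alpha>"
    unfolding \<alpha>_def using k mult_mono[of 1 "5 ^ DIM('a) :: real" 1 "2 * k"] by simp
  define m where "m = K * \<alpha>"
  have m: "1 \<le> m" unfolding m_def using \<alpha> K mult_mono[of 1 K 1 \<alpha>] by simp
  have D: "D = 2 * k * m" "0 < D" using k m by (auto simp: D_def m_def \<alpha>_def)
  \<comment> \<open>The rescaling by \<open>m\<close> reserves the room in which superlinearity
    later absorbs \<open>\<alpha>\<close>.\<close>
  define F where "F t = \<Phi> (t / ennreal m)" for t
  have F: "mono F" "ennreal (2 * k) * F t \<le> F (ennreal k * t)" for t
  proof -
    show "mono F" by (auto simp: mono_def F_def intro!: monoD[OF mono] divide_right_mono_ennreal)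
    show "ennreal (2 * k) * F t \<le> F (ennreal k * t)"
      using nabla[of "t / ennreal m"] by (simp add: F_def ennreal_times_divide)
  qed
  have pt: "\<Phi> (H / ennreal D) \<le> (\<integral>\<^sup>+j. F (ennreal (k powr j)) * indicator {j :: int. ennreal (2 * k powr j) < H} j
      \<partial>count_space (UNIV :: int set))" if fin: "H < top" for H
  proof (cases "H = 0")
    case True then show ?thesis by (simp add: zero)
  next
    case False
    then obtain h where h: "H = ennreal h" "0 < h"
      using fin by (cases H) auto
    \<comment> \<open>A single term of the sum already dominates: the one for the largest level
      \<open>2 k^j\<close> strictly below \<open>h\<close>.\<close>
    obtain j :: int where j: "k powr j < h / 2" "h / 2 \<le> k powr (j + 1)"
      using powr_bracket[OF k, of "h / 2"] h by auto
    have "h \<le> 2 * (k powr j * k)" using j k by (simp add: powr_add)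
    then have "h / D \<le> k powr j / m"
      using k m by (simp add: D field_simps)
    then have "\<Phi> (H / ennreal D) \<le> F (ennreal (k powr j))"
      using h D m by (auto simp: F_def divide_ennreal intro!: monoD[OF mono] ennreal_leI)
    also have "\<dots> = F (ennreal (k powr j)) * indicator {j :: int. ennreal (2 * k powr j) < H} j"
      using j h by (simp add: ennreal_less_iff)
    also have "\<dots> \<le> (\<integral>\<^sup>+j. F (ennreal (k powr j)) * indicator {j :: int. ennreal (2 * k powr j) < H} j
      \<partial>count_space (UNIV :: int set))"
      by (rule nn_integral_ge_point) simp
    finally show ?thesis .
  qed
  define E where "E j = {x. ennreal (2 * k powr j) < HL_max f x}" for j :: int
  have E[measurable]: "E j \<in> sets lebesgue" for j
    unfolding E_def using borel_measurable_less[OF borel_measurable_const HL_max_measurable[of f]] by simp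
  define A where "A j = {y. k powr j < \<bar>f y\<bar>}" for j :: int
  have A[measurable]: "A j \<in> sets lebesgue" for j
    unfolding A_def using borel_measurable_less[OF borel_measurable_const borel_measurable_abs[OF f]] by simp
  define W where "W j y = F (ennreal (k powr j)) * ennreal (\<bar>f y\<bar> / k powr j) * indicator (A j) y" for j y
  have W[measurable]: "W j \<in> borel_measurable lebesgue" for j
    unfolding W_def by measurable
  have 1: "F (ennreal (k powr j)) * emeasure lebesgue (E j) \<le> ennreal (5 ^ DIM('a)) * (\<integral>\<^sup>+y. W j y \<partial>lebesgue)" for j
  proof -
    let ?\<tau> = "k powr j"
    have \<tau>: "0 < ?\<tau>" using k by simp
    let ?I = "\<integral>\<^sup>+y. ennreal \<bar>f y\<bar> * indicator (A j) y \<partial>lebesgue"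
    have inv: "ennreal (1 / ?\<tau>) * ennreal ?\<tau> = 1"
      using \<tau> by (simp add: ennreal_mult[symmetric])
    have "emeasure lebesgue (E j) = ennreal (1 / ?\<tau>) * (ennreal ?\<tau> * emeasure lebesgue (E j))"
      by (simp only: mult.assoc[symmetric] inv mult_1)
    also have "\<dots> \<le> ennreal (1 / ?\<tau>) * (ennreal (5 ^ DIM('a)) * ?I)"
      unfolding E_def A_def by (intro mult_left_mono HL_max_level_estimate f \<tau>) simp
    finally have "F (ennreal ?\<tau>) * emeasure lebesgue (E j)
        \<le> F (ennreal ?\<tau>) * (ennreal (1 / ?\<tau>) * (ennreal (5 ^ DIM('a)) * ?I))"
      by (rule mult_left_mono) simp
    also have "\<dots> = ennreal (5 ^ DIM('a)) * ((F (ennreal ?\<tau>) * ennreal (1 / ?\<tau>)) * ?I)"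
      by (simp only: ac_simps)
    also have "(F (ennreal ?\<tau>) * ennreal (1 / ?\<tau>)) * ?I
      = (\<integral>\<^sup>+y. (F (ennreal ?\<tau>) * ennreal (1 / ?\<tau>)) * (ennreal \<bar>f y\<bar> * indicator (A j) y) \<partial>lebesgue)"
      by (rule nn_integral_cmult[symmetric]) measurable
    also have "\<dots> = (\<integral>\<^sup>+y. W j y \<partial>lebesgue)"
    proof (rule nn_integral_cong)
      fix y
      have "ennreal (\<bar>f y\<bar> / ?\<tau>) = ennreal (1 / ?\<tau>) * ennreal \<bar>f y\<bar>"
        using \<tau> by (simp add: ennreal_mult[symmetric])
      then show "(F (ennreal ?\<tau>) * ennreal (1 / ?\<tau>)) * (ennreal \<bar>f y\<bar> * indicator (A j) y) = W j y"
        unfolding W_def by (simp only: ac_simps)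
    qed
    finally show ?thesis .
  qed
  have 2: "(\<integral>\<^sup>+j. W j y \<partial>count_space UNIV) \<le> ennreal (2 * k) * F (ennreal \<bar>f y\<bar>)" for y
  proof (cases "f y = 0")
    case True then show ?thesis by (simp add: W_def)
  next
    case False
    then show ?thesis using dyadic_sum_le[OF F k, of "\<bar>f y\<bar>"] by (simp add: W_def A_def indicator_def)
  qed
  have "(\<integral>\<^sup>+x. \<Phi> (HL_max f x / ennreal D) \<partial>lebesgue)
     \<le> (\<integral>\<^sup>+x. (\<integral>\<^sup>+j. F (ennreal (k powr j)) * indicator (E j) x \<partial>count_space UNIV) \<partial>lebesgue)"
  proof (rule nn_integral_mono_AE)
    show "AE x in lebesgue. \<Phi> (HL_max f x / ennreal D)
        \<le> (\<integral>\<^sup>+j. F (ennreal (k powr j)) * indicator (E j) x \<partial>count_space UNIV)"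
      using HL_max_AE_finite[OF f int]
    proof (rule eventually_mono)
      fix x assume "HL_max f x < top"
      from pt[OF this] show "\<Phi> (HL_max f x / ennreal D)
        \<le> (\<integral>\<^sup>+j. F (ennreal (k powr j)) * indicator (E j) x \<partial>count_space UNIV)"
        by (simp add: E_def indicator_def)
    qed
  qed
  also have "\<dots> = (\<integral>\<^sup>+j. (\<integral>\<^sup>+x. F (ennreal (k powr j)) * indicator (E j) x \<partial>lebesgue) \<partial>count_space UNIV)"
    by (rule nn_integral_count_space_nn_integral) auto
  also have "\<dots> = (\<integral>\<^sup>+j. F (ennreal (k powr j)) * emeasure lebesgue (E j) \<partial>count_space UNIV)"
    by (intro nn_integral_cong nn_integral_cmult_indicator E)
  also have "\<dots> \<le> (\<integral>\<^sup>+j. ennreal (5 ^ DIM('a)) * (\<integral>\<^sup>+y. W j y \<partial>lebesgue) \<partial>count_space UNIV)"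
    by (intro nn_integral_mono 1)
  also have "\<dots> = ennreal (5 ^ DIM('a)) * (\<integral>\<^sup>+j. (\<integral>\<^sup>+y. W j y \<partial>lebesgue) \<partial>count_space UNIV)"
    by (rule nn_integral_cmult) simp
  also have "(\<integral>\<^sup>+j. (\<integral>\<^sup>+y. W j y \<partial>lebesgue) \<partial>count_space UNIV)
      = (\<integral>\<^sup>+y. (\<integral>\<^sup>+j. W j y \<partial>count_space UNIV) \<partial>lebesgue)"
    by (rule nn_integral_count_space_nn_integral[symmetric]) auto
  also have "ennreal (5 ^ DIM('a)) * \<dots> \<le> ennreal (5 ^ DIM('a)) * (\<integral>\<^sup>+y. ennreal (2 * k) * F (ennreal \<bar>f y\<bar>) \<partial>lebesgue)"
    by (intro mult_left_mono nn_integral_mono 2) simp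
  also have "\<dots> = (\<integral>\<^sup>+y. ennreal \<alpha> * F (ennreal \<bar>f y\<bar>) \<partial>lebesgue)"
    using k by (subst nn_integral_cmult[symmetric])
      (auto simp: F_def \<alpha>_def ennreal_mult mult.assoc)
  also have "\<dots> \<le> (\<integral>\<^sup>+y. \<Phi> (ennreal \<bar>f y\<bar>) \<partial>lebesgue)"
  proof (rule nn_integral_mono)
    fix y
    have "ennreal \<alpha> * F (ennreal \<bar>f y\<bar>) \<le> \<Phi> (ennreal m * (ennreal \<bar>f y\<bar> / ennreal m))"
      unfolding F_def m_def by (rule superlinear[OF \<alpha>])
    then show "ennreal \<alpha> * F (ennreal \<bar>f y\<bar>) \<le> \<Phi> (ennreal \<bar>f y\<bar>)"
      using m by (simp add: ennreal_mult_divide_cancel)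
  qed
  also note int
  finally show ?thesis .
qed

end

section \<open>Orlicz norms\<close>

lemma divide_left_mono_ennreal:
  assumes "0 < c" "c \<le> d"
  shows "x / ennreal d \<le> x / ennreal c"
  using assms by (cases x) (auto simp: divide_ennreal ennreal_top_divide intro!: ennreal_leI divide_left_mono)

lemma divide_divide_ennreal:
  assumes "0 < c" "0 < d"
  shows "x / ennreal c / ennreal d = x / ennreal (c * d)"
  using assms by (cases x) (auto simp: divide_ennreal ennreal_top_divide)

lemma orlicz_norm_le:
  assumes "0 < c" "(\<integral>\<^sup>+x. \<Phi> (g x / ennreal c) \<partial>lebesgue) \<le> 1"
  shows "orlicz_norm \<Phi> g \<le> ennreal c"
  unfolding orlicz_norm_def by (rule Inf_lower) (use assms in auto)

lemma weak_orlicz_norm_le: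
  assumes "0 < c" "\<And>t. 0 < t \<Longrightarrow> \<Phi> t * distrib (\<lambda>x. g x / ennreal c) t \<le> 1"
  shows "weak_orlicz_norm \<Phi> g \<le> ennreal c"
  unfolding weak_orlicz_norm_def
  by (rule Inf_lower) (use assms in \<open>auto intro!: SUP_least\<close>)

lemma orlicz_norm_lessD:
  assumes "mono \<Phi>" and less: "orlicz_norm \<Phi> g < ennreal c"
  shows "(\<integral>\<^sup>+x. \<Phi> (g x / ennreal c) \<partial>lebesgue) \<le> 1"
proof -
  obtain c' where c': "0 < c'" "ennreal c' < ennreal c" "(\<integral>\<^sup>+x. \<Phi> (g x / ennreal c') \<partial>lebesgue) \<le> 1"
    using less by (auto simp: orlicz_norm_def Inf_less_iff)
  have "(\<integral>\<^sup>+x. \<Phi> (g x / ennreal c) \<partial>lebesgue) \<le> (\<integral>\<^sup>+x. \<Phi> (g x / ennreal c') \<partial>lebesgue)"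
    using c' by (intro nn_integral_mono monoD[OF assms(1)] divide_left_mono_ennreal) (auto simp: ennreal_less_iff)
  also note c'(3)
  finally show ?thesis .
qed

context growth_function
begin

text \<open>Membership gives a finite modular \<open>N\<close> at some scale; shrinking the argument
  by \<open>K \<alpha>\<close> with \<open>\<alpha> \<ge> N\<close> divides the modular by at least
  \<open>\<alpha>\<close>.\<close>

lemma orlicz_norm_finite:
  assumes "f \<in> orlicz_space \<Phi>"
  shows "orlicz_norm \<Phi> (\<lambda>y. ennreal \<bar>f y\<bar>) < top"
proof -
  obtain \<epsilon> where f[measurable]: "f \<in> borel_measurable lebesgue" and \<epsilon>: "0 < \<epsilon>"
    and fin: "(\<integral>\<^sup>+x. \<Phi> (ennreal (\<epsilon> * \<bar>f x\<bar>)) \<partial>lebesgue) < top"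
    using assms by (auto simp: orlicz_space_def)
  obtain N where N: "0 \<le> N" "(\<integral>\<^sup>+x. \<Phi> (ennreal (\<epsilon> * \<bar>f x\<bar>)) \<partial>lebesgue) = ennreal N"
    using fin by (auto simp: less_top_ennreal)
  define \<alpha> where "\<alpha> = max 1 N"
  have \<alpha>: "1 \<le> \<alpha>" "N \<le> \<alpha>" by (auto simp: \<alpha>_def)
  define c where "c = K * \<alpha> / \<epsilon>"
  have c: "0 < c" using K \<alpha> \<epsilon> by (auto simp: c_def)
  have "ennreal \<alpha> * (\<integral>\<^sup>+x. \<Phi> (ennreal \<bar>f x\<bar> / ennreal c) \<partial>lebesgue)
      = (\<integral>\<^sup>+x. ennreal \<alpha> * \<Phi> (ennreal \<bar>f x\<bar> / ennreal c) \<partial>lebesgue)"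
    by (rule nn_integral_cmult[symmetric]) measurable
  also have "\<dots> \<le> (\<integral>\<^sup>+x. \<Phi> (ennreal (\<epsilon> * \<bar>f x\<bar>)) \<partial>lebesgue)"
  proof (rule nn_integral_mono)
    fix x
    have "ennreal (K * \<alpha>) * (ennreal \<bar>f x\<bar> / ennreal c) = ennreal (\<epsilon> * \<bar>f x\<bar>)"
      using c K \<alpha> \<epsilon> by (simp add: divide_ennreal ennreal_mult'[symmetric] c_def)
    then show "ennreal \<alpha> * \<Phi> (ennreal \<bar>f x\<bar> / ennreal c) \<le> \<Phi> (ennreal (\<epsilon> * \<bar>f x\<bar>))"
      using superlinear[OF \<alpha>(1), of "ennreal \<bar>f x\<bar> / ennreal c"] by simp
  qed
  also have "\<dots> \<le> ennreal \<alpha> * 1" using N \<alpha> by (simp add: ennreal_leI)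
  finally have "(\<integral>\<^sup>+x. \<Phi> (ennreal \<bar>f x\<bar> / ennreal c) \<partial>lebesgue) \<le> 1"
    by (rule ennreal_mult_le_mult_iff[THEN iffD1, rotated 2]) (use \<alpha> in auto)
  then show ?thesis using orlicz_norm_le[OF c, of \<Phi> "\<lambda>y. ennreal \<bar>f y\<bar>"] by (auto intro: le_less_trans)
qed

text \<open>When every scale is admissible, superlinearity bounds the modular of
  \<open>n |f|\<close> by \<open>1 / \<alpha>\<close> for all \<open>\<alpha> \<ge> 1\<close>, so it
  vanishes. Since \<open>\<Phi>\<close> may vanish near 0, one multiple proves nothing; all
  \<open>n\<close> together with the unboundedness of \<open>\<Phi>\<close> force
  \<open>f y = 0\<close>.\<close>

lemma orlicz_norm_zero_AE:
  fixes f :: "'a::euclidean_space \<Rightarrow> real"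
  assumes f[measurable]: "f \<in> borel_measurable lebesgue"
    and zero_norm: "orlicz_norm \<Phi> (\<lambda>y. ennreal \<bar>f y\<bar>) = 0"
  shows "AE y in lebesgue. f y = 0"
proof -
  have null: "AE y in lebesgue. \<Phi> (ennreal \<bar>f y\<bar> * of_nat n) = 0" for n
  proof -
    let ?I = "\<integral>\<^sup>+y. \<Phi> (ennreal \<bar>f y\<bar> * of_nat n) \<partial>lebesgue"
    have bound: "ennreal \<alpha> * ?I \<le> 1" if \<alpha>: "1 \<le> \<alpha>" for \<alpha>
    proof -
      \<comment> \<open>The summand 1 keeps \<open>c\<close> well defined and positive for
        \<open>n = 0\<close>.\<close>
      define c where "c = 1 / (K * \<alpha> * (real n + 1))"
      have c: "0 < c" using K \<alpha> by (simp add: c_def)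
      have "ennreal \<alpha> * ?I = (\<integral>\<^sup>+y. ennreal \<alpha> * \<Phi> (ennreal \<bar>f y\<bar> * of_nat n) \<partial>lebesgue)"
        by (rule nn_integral_cmult[symmetric]) measurable
      also have "\<dots> \<le> (\<integral>\<^sup>+y. \<Phi> (ennreal \<bar>f y\<bar> / ennreal c) \<partial>lebesgue)"
      proof (rule nn_integral_mono)
        fix y
        have "\<bar>f y\<bar> * (K * \<alpha> * real n) \<le> \<bar>f y\<bar> / c"
          using K \<alpha> by (auto simp: c_def intro!: mult_left_mono)
        then have "ennreal (K * \<alpha>) * (ennreal \<bar>f y\<bar> * of_nat n) \<le> ennreal \<bar>f y\<bar> / ennreal c"
          using c K \<alpha>
          by (auto simp: divide_ennreal ennreal_of_nat_eq_real_of_nat ennreal_mult'[symmetric] ac_simps intro!: ennreal_leI)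
        then show "ennreal \<alpha> * \<Phi> (ennreal \<bar>f y\<bar> * of_nat n) \<le> \<Phi> (ennreal \<bar>f y\<bar> / ennreal c)"
          using superlinear[OF \<alpha>] monoD[OF mono] order_trans by blast
      qed
      also have "\<dots> \<le> 1"
        using c zero_norm by (intro orlicz_norm_lessD mono) simp
      finally show ?thesis .
    qed
    have "?I = 0"
    proof (cases ?I)
      case (real e)
      show ?thesis
      proof (rule ccontr)
        assume "?I \<noteq> 0"
        then have e: "0 < e" using real by auto
        have "max 1 (2 / e) * e \<le> 1"
          using bound[of "max 1 (2 / e)"] real e by (simp add: ennreal_mult'[symmetric])
        moreover have "2 / e * e \<le> max 1 (2 / e) * e" using e by (intro mult_right_mono) auto
        ultimately show False using e by simp
      qed
    next
      case top
      then show ?thesis using bound[of 1] by (simp add: top_unique)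
    qed
    then show ?thesis by (subst (asm) nn_integral_0_iff_AE) auto
  qed
  have "AE y in lebesgue. \<forall>n. \<Phi> (ennreal \<bar>f y\<bar> * of_nat n) = 0"
    using null by (simp add: AE_all_countable)
  then show ?thesis
  proof (rule eventually_mono)
    fix y assume y: "\<forall>n. \<Phi> (ennreal \<bar>f y\<bar> * of_nat n) = 0"
    show "f y = 0"
    proof (rule ccontr)
      assume ne: "f y \<noteq> 0"
      obtain s where s: "s < top" "0 < \<Phi> s" using Pbar_unbounded[OF Pbar, of 0] by auto
      have "s / ennreal \<bar>f y\<bar> < top"
        using s ne by (auto simp: ennreal_divide_eq_top_iff less_top[symmetric])
      then obtain n where "s / ennreal \<bar>f y\<bar> < of_nat n" using ennreal_Ex_less_of_nat by blast
      then have "s \<le> ennreal \<bar>f y\<bar> * of_nat n"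
        using ne by (subst (asm) divide_less_ennreal) (auto simp: mult.commute)
      then have "\<Phi> s \<le> 0" using monoD[OF mono] y by metis
      then show False using s by simp
    qed
  qed
qed

text \<open>The factor \<open>2\<close> replaces the attainment of the infimum defining the norm, which would need
  a limit argument.\<close>

lemma orlicz_norm_real:
  fixes f :: "'a::euclidean_space \<Rightarrow> real"
  assumes f: "f \<in> orlicz_space \<Phi>" and ne: "\<not> (AE y in lebesgue. f y = 0)"
  obtains \<nu> where "0 < \<nu>" "orlicz_norm \<Phi> (\<lambda>y. ennreal \<bar>f y\<bar>) = ennreal \<nu>"
    "(\<integral>\<^sup>+y. \<Phi> (ennreal \<bar>f y / (2 * \<nu>)\<bar>) \<partial>lebesgue) \<le> 1"
proof -
  have meas: "f \<in> borel_measurable lebesgue" using f by (simp add: orlicz_space_def)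
  obtain \<nu> where \<nu>: "0 \<le> \<nu>" "orlicz_norm \<Phi> (\<lambda>y. ennreal \<bar>f y\<bar>) = ennreal \<nu>"
    using orlicz_norm_finite[OF f] by (auto simp: less_top_ennreal)
  have pos: "0 < \<nu>" using orlicz_norm_zero_AE[OF meas] ne \<nu> by (cases "\<nu> = 0") auto
  have "(\<integral>\<^sup>+y. \<Phi> (ennreal \<bar>f y\<bar> / ennreal (2 * \<nu>)) \<partial>lebesgue) \<le> 1"
    using \<nu> pos by (intro orlicz_norm_lessD mono) (simp add: ennreal_less_iff)
  also have "(\<lambda>y. ennreal \<bar>f y\<bar> / ennreal (2 * \<nu>)) = (\<lambda>y. ennreal \<bar>f y / (2 * \<nu>)\<bar>)"
    using pos by (auto simp: divide_ennreal)
  finally show thesis using that pos \<nu> by blast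
qed

end

section \<open>The pointwise estimate and the boundedness of \<open>frac_max\<close>\<close>

text \<open>Averages do not see null sets, so the value is 0 at every point. This treats the
  functions excluded from the pointwise estimate.\<close>

lemma frac_max_AE_zero:
  fixes f :: "'a::euclidean_space \<Rightarrow> real"
  assumes "AE y in lebesgue. f y = 0"
  shows "frac_max \<rho> f x = 0"
proof -
  have "(\<integral>\<^sup>+y\<in>ball z r. ennreal \<bar>f y\<bar> \<partial>lebesgue) = (\<integral>\<^sup>+(y::'a). 0 \<partial>lebesgue)" for z :: 'a and r
    by (rule nn_integral_cong_AE) (use assms in \<open>auto elim!: eventually_mono\<close>)
  then have "frac_max \<rho> f x \<le> 0"
    unfolding frac_max_def by (intro SUP_least) (simp add: ball_avg_def)
  then show ?thesis by simp
qed

lemma le_0_ennrealI: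
  fixes x :: ennreal
  assumes "\<And>c. 0 < c \<Longrightarrow> x \<le> ennreal c"
  shows "x = 0"
proof -
  have "x \<le> 0" by (rule ennreal_le_epsilon) (use assms in auto)
  then show ?thesis by simp
qed

lemma weak_orlicz_norm_zero: "weak_orlicz_norm \<Phi> (\<lambda>x. 0) = 0"
  by (rule le_0_ennrealI) (auto intro!: weak_orlicz_norm_le simp: distrib_def)

lemma orlicz_norm_zero: "\<Phi> 0 = 0 \<Longrightarrow> orlicz_norm \<Phi> (\<lambda>x. 0) = 0"
  by (rule le_0_ennrealI) (auto intro!: orlicz_norm_le)

lemma gen_inv_mono:
  assumes "\<Psi> \<in> Pbar" "u \<le> v" "v < top"
  shows "gen_inv \<Psi> u \<le> gen_inv \<Psi> v"
  using assms le_gen_inv_iff[of \<Psi> u "gen_inv \<Psi> u"] le_gen_inv_iff[of \<Psi> v "gen_inv \<Psi> u"]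
  by (auto intro: order_trans le_less_trans)

text \<open>Because the condition has a supremum over \<open>t \<le> r\<close>, a value of
  \<open>\<rho>\<close> at a small radius can be paired with the inverses at a larger one.\<close>

lemma cond_iD:
  assumes "cond_i \<rho> \<Phi> \<Psi> n A" "0 < t" "t \<le> r"
  shows "ennreal (\<rho> t) * gen_inv \<Phi> (ennreal (1 / r ^ n)) \<le> ennreal A * gen_inv \<Psi> (ennreal (1 / r ^ n))"
proof -
  have "ennreal (\<rho> t) \<le> (SUP t\<in>{0<..r}. ennreal (\<rho> t))"
    using assms by (intro SUP_upper) auto
  then have "ennreal (\<rho> t) * gen_inv \<Phi> (ennreal (1 / r ^ n))
      \<le> (SUP t\<in>{0<..r}. ennreal (\<rho> t)) * gen_inv \<Phi> (ennreal (1 / r ^ n))"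
    by (rule mult_right_mono) simp
  also have "\<dots> \<le> ennreal A * gen_inv \<Psi> (ennreal (1 / r ^ n))"
    using assms by (simp add: cond_i_def)
  finally show ?thesis .
qed

context growth_function
begin

text \<open>The claim is first proved with any \<open>v\<close> strictly between 0 and infinity on
  the right, \<open>\<Phi> u \<le> v\<close>; density of the order then gives
  \<open>\<Phi> u\<close> itself, whose values 0 and infinity correspond to no radius.\<close>

lemma frac_max_pointwise:
  assumes Psi: "\<Psi> \<in> Pbar" and A: "0 < A" and cond: "cond_i \<rho> \<Phi> \<Psi> DIM('a::euclidean_space) A"
    and C0: "0 < C0"
  obtains C1 where "0 < C1" "\<And>f x. f \<in> orlicz_space \<Phi> \<Longrightarrow> \<not> (AE y in lebesgue. f y = 0) \<Longrightarrow>
    \<Psi> (frac_max \<rho> f (x :: 'a) / (ennreal C1 * orlicz_norm \<Phi> (\<lambda>y. ennreal \<bar>f y\<bar>)))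
      \<le> \<Phi> (HL_max f x / (ennreal C0 * orlicz_norm \<Phi> (\<lambda>y. ennreal \<bar>f y\<bar>)))"
proof -
  define Cb where "Cb = 2 * K * (K * max 1 (1 / unit_ball_vol DIM('a)))"
  have Cb: "0 < Cb" using K by (simp add: Cb_def)
  \<comment> \<open>\<open>C0\<close> serves the balls of radius at most \<open>r0\<close> and
    \<open>2 * Cb\<close> the larger ones; the 2 comes from the admissible scale
    \<open>2 * \<nu>\<close>.\<close>
  define C1 where "C1 = A * max C0 (2 * Cb)"
  have C1: "0 < C1" "C0 * A \<le> C1" "2 * Cb * A \<le> C1"
    using A C0 by (auto simp: C1_def mult.commute intro!: mult_left_mono)
  show thesis
  proof (rule that[OF C1(1)])
    fix f :: "'a \<Rightarrow> real" and x
    assume f: "f \<in> orlicz_space \<Phi>" and ne: "\<not> (AE y in lebesgue. f y = 0)"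
    obtain \<nu> where \<nu>: "0 < \<nu>" and norm: "orlicz_norm \<Phi> (\<lambda>y. ennreal \<bar>f y\<bar>) = ennreal \<nu>"
      and int: "(\<integral>\<^sup>+y. \<Phi> (ennreal \<bar>f y / (2 * \<nu>)\<bar>) \<partial>lebesgue) \<le> 1"
      using orlicz_norm_real[OF f ne] by blast
    have meas[measurable]: "f \<in> borel_measurable lebesgue" using f by (simp add: orlicz_space_def)
    define u where "u = HL_max f x / ennreal (C0 * \<nu>)"
    have HL: "HL_max f x = ennreal (C0 * \<nu>) * u"
      using C0 \<nu> by (simp add: u_def ennreal_mult_divide_cancel)
    have avg: "ball_avg f z r \<le> ennreal (2 * \<nu> * Cb) * gen_inv \<Phi> (ennreal (1 / r ^ DIM('a)))" if r: "0 < r" for z r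
    proof -
      have "ball_avg f z r = ennreal (2 * \<nu>) * ball_avg (\<lambda>y. f y / (2 * \<nu>)) z r"
        using \<nu> by (simp add: ball_avg_divide ennreal_mult_divide_cancel)
      also have "\<dots> \<le> ennreal (2 * \<nu>) * (ennreal Cb * gen_inv \<Phi> (ennreal (1 / r ^ DIM('a))))"
        unfolding Cb_def by (intro mult_left_mono ball_avg_le_gen_inv int r) auto
      also have "\<dots> = ennreal (2 * \<nu> * Cb) * gen_inv \<Phi> (ennreal (1 / r ^ DIM('a)))"
        using \<nu> Cb by (simp add: ennreal_mult mult.assoc)
      finally show ?thesis .
    qed
    have level: "\<Psi> (frac_max \<rho> f x / ennreal (C1 * \<nu>)) \<le> v" if v: "\<Phi> u \<le> v" "0 < v" "v < top" for v
    proof -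
      obtain w where w: "v = ennreal w" "0 < w" using v by (cases v) auto
      define r0 where "r0 = root DIM('a) (1 / w)"
      have r0: "0 < r0" "v = ennreal (1 / r0 ^ DIM('a))"
        using w by (auto simp: r0_def)
      have "frac_max \<rho> f x \<le> ennreal (C1 * \<nu>) * gen_inv \<Psi> v"
        unfolding frac_max_def
      proof (rule SUP_least, clarsimp simp del: mem_ball)
        fix z r assume r: "0 < r" and x: "x \<in> ball z r"
        show "ennreal (\<rho> r) * ball_avg f z r \<le> ennreal (C1 * \<nu>) * gen_inv \<Psi> v"
        proof (cases "r \<le> r0")
          case True
          have "ball_avg f z r \<le> ennreal (C0 * \<nu>) * u"
            using ball_avg_le_HL_max[OF r x, of f] by (simp add: HL)
          also have "\<dots> \<le> ennreal (C0 * \<nu>) * gen_inv \<Phi> v"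
            using v by (intro mult_left_mono) (simp_all add: le_inv_iff)
          finally have "ennreal (\<rho> r) * ball_avg f z r \<le> ennreal (\<rho> r) * (ennreal (C0 * \<nu>) * gen_inv \<Phi> v)"
            by (rule mult_left_mono) simp
          also have "\<dots> = ennreal (C0 * \<nu>) * (ennreal (\<rho> r) * gen_inv \<Phi> v)"
            by (rule mult.left_commute)
          also have "\<dots> \<le> ennreal (C0 * \<nu>) * (ennreal A * gen_inv \<Psi> v)"
            unfolding r0(2) by (intro mult_left_mono cond_iD[OF cond r True]) simp
          also have "\<dots> = ennreal (C0 * \<nu> * A) * gen_inv \<Psi> v"
            using C0 \<nu> A by (simp add: ennreal_mult mult.assoc)
          also have "\<dots> \<le> ennreal (C1 * \<nu>) * gen_inv \<Psi> v"
            using mult_right_mono[OF C1(2), of \<nu>] \<nu>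
            by (intro mult_right_mono ennreal_leI) (auto simp: ac_simps)
          finally show ?thesis .
        next
          case False
          \<comment> \<open>For a large ball the condition is used at \<open>r\<close> itself, and
            monotonicity of the inverse of \<open>\<Psi>\<close> returns to the level
            \<open>v\<close>.\<close>
          let ?v = "ennreal (1 / r ^ DIM('a))"
          have "1 / r ^ DIM('a) \<le> 1 / r0 ^ DIM('a)"
            using False r0 r by (intro divide_left_mono power_mono) auto
          then have mono: "gen_inv \<Psi> ?v \<le> gen_inv \<Psi> v"
            unfolding r0(2) by (intro gen_inv_mono[OF Psi] ennreal_leI) auto
          have "ennreal (\<rho> r) * ball_avg f z r \<le> ennreal (\<rho> r) * (ennreal (2 * \<nu> * Cb) * gen_inv \<Phi> ?v)"
            by (intro mult_left_mono avg r) simp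
          also have "\<dots> = ennreal (2 * \<nu> * Cb) * (ennreal (\<rho> r) * gen_inv \<Phi> ?v)"
            by (rule mult.left_commute)
          also have "\<dots> \<le> ennreal (2 * \<nu> * Cb) * (ennreal A * gen_inv \<Psi> ?v)"
            by (intro mult_left_mono cond_iD[OF cond r]) auto
          also have "\<dots> \<le> ennreal (2 * \<nu> * Cb) * (ennreal A * gen_inv \<Psi> v)"
            by (intro mult_left_mono mono) auto
          also have "\<dots> = ennreal (2 * \<nu> * Cb * A) * gen_inv \<Psi> v"
            using Cb \<nu> A by (simp add: ennreal_mult mult.assoc)
          also have "\<dots> \<le> ennreal (C1 * \<nu>) * gen_inv \<Psi> v"
            using mult_right_mono[OF C1(3), of \<nu>] \<nu>
            by (intro mult_right_mono ennreal_leI) (auto simp: ac_simps)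
          finally show ?thesis .
        qed
      qed
      then have "frac_max \<rho> f x / ennreal (C1 * \<nu>) \<le> gen_inv \<Psi> v"
        using C1 \<nu> by (subst divide_le_iff_ennreal) (auto simp: mult.commute)
      then show ?thesis using le_gen_inv_iff[OF Psi v(3)] by simp
    qed
    have "\<Psi> (frac_max \<rho> f x / ennreal (C1 * \<nu>)) \<le> \<Phi> u"
    proof (rule ccontr)
      assume "\<not> ?thesis"
      then obtain v where v: "\<Phi> u < v" "v < \<Psi> (frac_max \<rho> f x / ennreal (C1 * \<nu>))"
        using dense by (metis not_le)
      then have "0 < v" "v < top" using le_less_trans[OF zero_le] less_le_trans[OF v(2) top_greatest] by auto
      then show False using level[of v] v by (simp add: not_le[symmetric])
    qed
    then show "\<Psi> (frac_max \<rho> f x / (ennreal C1 * orlicz_norm \<Phi> (\<lambda>y. ennreal \<bar>f y\<bar>)))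
      \<le> \<Phi> (HL_max f x / (ennreal C0 * orlicz_norm \<Phi> (\<lambda>y. ennreal \<bar>f y\<bar>)))"
      using C0 C1 \<nu> by (simp add: norm u_def ennreal_mult)
  qed
qed

lemma HL_max_rescale:
  assumes "f \<in> borel_measurable lebesgue" "0 < \<nu>" "0 < D"
  shows "HL_max f x / (ennreal (2 * D) * ennreal \<nu>) = HL_max (\<lambda>y. f y / (2 * \<nu>)) x / ennreal D"
  using assms by (simp add: HL_max_divide divide_divide_ennreal ennreal_mult[symmetric] ac_simps)

text \<open>By the pointwise estimate, \<open>t < ?F x\<close> implies
  \<open>\<Psi> t \<le> ?G x\<close>, and the weak modular bound for \<open>HL_max\<close> measures
  that set. Taking \<open>C0 = 2 D\<close> accounts for the normalization of \<open>f\<close> by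
  \<open>2 \<nu>\<close>.\<close>

lemma frac_max_bounded_weak:
  assumes Psi: "\<Psi> \<in> Pbar" and A: "0 < A" and cond: "cond_i \<rho> \<Phi> \<Psi> DIM('a::euclidean_space) A"
  shows "bounded_weak (frac_max \<rho> :: ('a \<Rightarrow> real) \<Rightarrow> 'a \<Rightarrow> ennreal) \<Phi> \<Psi>"
proof -
  define D where "D = 4 * K * (K * 5 ^ DIM('a))"
  have D: "0 < D" using K by (simp add: D_def)
  obtain C1 where C1: "0 < C1" and pointwise: "\<And>f x. f \<in> orlicz_space \<Phi> \<Longrightarrow> \<not> (AE y in lebesgue. f y = 0) \<Longrightarrow>
    \<Psi> (frac_max \<rho> f (x :: 'a) / (ennreal C1 * orlicz_norm \<Phi> (\<lambda>y. ennreal \<bar>f y\<bar>)))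
      \<le> \<Phi> (HL_max f x / (ennreal (2 * D) * orlicz_norm \<Phi> (\<lambda>y. ennreal \<bar>f y\<bar>)))"
    using frac_max_pointwise[OF Psi A cond, of "2 * D"] D by auto
  have "weak_orlicz_norm \<Psi> (frac_max \<rho> f) \<le> ennreal C1 * orlicz_norm \<Phi> (\<lambda>x. ennreal \<bar>f x\<bar>)"
    if f: "f \<in> orlicz_space \<Phi>" for f :: "'a \<Rightarrow> real"
  proof (cases "AE y in lebesgue. f y = 0")
    case True
    then have "frac_max \<rho> f = (\<lambda>x. 0)" using frac_max_AE_zero by blast
    then show ?thesis by (simp add: weak_orlicz_norm_zero)
  next
    case False
    obtain \<nu> where \<nu>: "0 < \<nu>" and norm: "orlicz_norm \<Phi> (\<lambda>y. ennreal \<bar>f y\<bar>) = ennreal \<nu>"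
      and int: "(\<integral>\<^sup>+y. \<Phi> (ennreal \<bar>f y / (2 * \<nu>)\<bar>) \<partial>lebesgue) \<le> 1"
      using orlicz_norm_real[OF f False] by blast
    have meas[measurable]: "f \<in> borel_measurable lebesgue" using f by (simp add: orlicz_space_def)
    have g: "(\<lambda>y. f y / (2 * \<nu>)) \<in> borel_measurable lebesgue" by measurable
    let ?G = "\<lambda>x. \<Phi> (HL_max (\<lambda>y. f y / (2 * \<nu>)) x / ennreal D)"
    let ?F = "\<lambda>x. frac_max \<rho> f x / ennreal (C1 * \<nu>)"
    have le: "\<Psi> (?F x) \<le> ?G x" for x
      using pointwise[OF f False, of x] C1 \<nu> HL_max_rescale[OF meas \<nu> D, of x]
      by (simp add: norm ennreal_mult)
    have weak: "ennreal v * emeasure lebesgue {x. ennreal v \<le> ?G x} \<le> 1" if "0 < v" for v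
      unfolding D_def by (rule HL_max_weak_modular[OF g int that])
    have meas_G: "{x. v \<le> ?G x} \<in> sets lebesgue" for v
      using borel_measurable_le[OF borel_measurable_const, of ?G lebesgue v] by simp
    have dist: "distrib ?F t \<le> emeasure lebesgue {x. v \<le> ?G x}" if "v \<le> \<Psi> t" for t v
      unfolding distrib_def
    proof (rule emeasure_mono[OF _ meas_G])
      show "{x. t < ?F x} \<subseteq> {x. v \<le> ?G x}"
        using le monoD[OF Pbar_mono[OF Psi]] that by (blast intro: order_trans less_imp_le)
    qed
    have "\<Psi> t * distrib ?F t \<le> 1" for t
    proof (cases "\<Psi> t")
      case (real v)
      show ?thesis
      proof (cases "v = 0")
        case False
        then have "ennreal v * distrib ?F t \<le> ennreal v * emeasure lebesgue {x. ennreal v \<le> ?G x}"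
          using real by (intro mult_left_mono dist) auto
        also have "\<dots> \<le> 1" using False real by (intro weak) auto
        finally show ?thesis using real by simp
      qed (use real in simp)
    next
      case top
      \<comment> \<open>If \<open>\<Psi> t\<close> is infinite, every finite \<open>v\<close> bounds
        the level set by \<open>1 / v\<close>; it is null, and infinity times 0 is 0.\<close>
      have le1: "ennreal v * distrib ?F t \<le> 1" if "0 < v" for v
      proof -
        have "ennreal v * distrib ?F t \<le> ennreal v * emeasure lebesgue {x. ennreal v \<le> ?G x}"
          using top by (intro mult_left_mono dist) auto
        also have "\<dots> \<le> 1" by (rule weak[OF that])
        finally show ?thesis .
      qed
      have "distrib ?F t = 0"
      proof (rule le_0_ennrealI)
        fix c :: real assume c: "0 < c"
        have "ennreal (1 / c) * distrib ?F t \<le> 1" using c by (intro le1) simp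
        then have "distrib ?F t \<le> 1 / ennreal (1 / c)"
          using c by (subst le_divide_iff_ennreal) (auto simp: mult.commute)
        then show "distrib ?F t \<le> ennreal c" using c divide_ennreal[of 1 "1 / c"] by simp
      qed
      then show ?thesis by simp
    qed
    then have "weak_orlicz_norm \<Psi> (frac_max \<rho> f) \<le> ennreal (C1 * \<nu>)"
      using C1 \<nu> by (intro weak_orlicz_norm_le) auto
    then show ?thesis using C1 \<nu> by (simp add: norm ennreal_mult)
  qed
  then show ?thesis unfolding bounded_weak_def using C1 frac_max_measurable by blast
qed

lemma frac_max_bounded_strong:
  assumes Psi: "\<Psi> \<in> Pbar" and A: "0 < A" and cond: "cond_i \<rho> \<Phi> \<Psi> DIM('a::euclidean_space) A"
    and nabla: "\<Phi> \<in> nabla2"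
  shows "bounded_strong (frac_max \<rho> :: ('a \<Rightarrow> real) \<Rightarrow> 'a \<Rightarrow> ennreal) \<Phi> \<Psi>"
proof -
  obtain k :: real where k: "1 < k" and le: "\<And>t. 0 < t \<Longrightarrow> \<Phi> t \<le> \<Phi> (ennreal k * t) / ennreal (2 * k)"
    using nabla by (auto simp: nabla2_def)
  \<comment> \<open>\<open>nabla2\<close> speaks of positive \<open>t\<close> only; at 0 both sides
    vanish.\<close>
  have dbl: "ennreal (2 * k) * \<Phi> t \<le> \<Phi> (ennreal k * t)" for t
  proof (cases "t = 0")
    case False
    then show ?thesis
      using le[of t] k le_divide_iff_ennreal[of "ennreal (2 * k)" "\<Phi> t"]
      by (simp add: zero_less_iff_neq_zero mult.commute)
  qed (simp add: zero)
  define D where "D = 2 * k * (K * (5 ^ DIM('a) * (2 * k)))"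
  have D: "0 < D" using K k by (simp add: D_def)
  obtain C1 where C1: "0 < C1" and pointwise: "\<And>f x. f \<in> orlicz_space \<Phi> \<Longrightarrow> \<not> (AE y in lebesgue. f y = 0) \<Longrightarrow>
    \<Psi> (frac_max \<rho> f (x :: 'a) / (ennreal C1 * orlicz_norm \<Phi> (\<lambda>y. ennreal \<bar>f y\<bar>)))
      \<le> \<Phi> (HL_max f x / (ennreal (2 * D) * orlicz_norm \<Phi> (\<lambda>y. ennreal \<bar>f y\<bar>)))"
    using frac_max_pointwise[OF Psi A cond, of "2 * D"] D by auto
  have "orlicz_norm \<Psi> (frac_max \<rho> f) \<le> ennreal C1 * orlicz_norm \<Phi> (\<lambda>x. ennreal \<bar>f x\<bar>)"
    if f: "f \<in> orlicz_space \<Phi>" for f :: "'a \<Rightarrow> real"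
  proof (cases "AE y in lebesgue. f y = 0")
    case True
    then have "frac_max \<rho> f = (\<lambda>x. 0)" using frac_max_AE_zero by blast
    then show ?thesis by (simp add: orlicz_norm_zero Pbar_zero[OF Psi])
  next
    case False
    obtain \<nu> where \<nu>: "0 < \<nu>" and norm: "orlicz_norm \<Phi> (\<lambda>y. ennreal \<bar>f y\<bar>) = ennreal \<nu>"
      and int: "(\<integral>\<^sup>+y. \<Phi> (ennreal \<bar>f y / (2 * \<nu>)\<bar>) \<partial>lebesgue) \<le> 1"
      using orlicz_norm_real[OF f False] by blast
    have meas[measurable]: "f \<in> borel_measurable lebesgue" using f by (simp add: orlicz_space_def)
    have g: "(\<lambda>y. f y / (2 * \<nu>)) \<in> borel_measurable lebesgue" by measurable
    have "(\<integral>\<^sup>+x. \<Psi> (frac_max \<rho> f x / ennreal (C1 * \<nu>)) \<partial>lebesgue)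
        \<le> (\<integral>\<^sup>+x. \<Phi> (HL_max (\<lambda>y. f y / (2 * \<nu>)) x / ennreal D) \<partial>lebesgue)"
    proof (rule nn_integral_mono)
      show "\<Psi> (frac_max \<rho> f x / ennreal (C1 * \<nu>)) \<le> \<Phi> (HL_max (\<lambda>y. f y / (2 * \<nu>)) x / ennreal D)" for x
        using pointwise[OF f False, of x] C1 \<nu> HL_max_rescale[OF meas \<nu> D, of x]
        by (simp add: norm ennreal_mult)
    qed
    also have "\<dots> \<le> 1"
      unfolding D_def by (rule HL_max_strong_modular[OF g int k dbl])
    finally have "orlicz_norm \<Psi> (frac_max \<rho> f) \<le> ennreal (C1 * \<nu>)"
      using C1 \<nu> by (intro orlicz_norm_le) auto
    then show ?thesis using C1 \<nu> by (simp add: norm ennreal_mult)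
  qed
  then show ?thesis unfolding bounded_strong_def using C1 frac_max_measurable by blast
qed

end

lemma PbarY_growth_function:
  assumes "\<Phi> \<in> PbarY"
  obtains K where "growth_function \<Phi> K"
proof -
  obtain K :: real where "1 \<le> K" "\<And>\<alpha> t. 1 \<le> \<alpha> \<Longrightarrow> ennreal \<alpha> * \<Phi> t \<le> \<Phi> (ennreal (K * \<alpha>) * t)"
    using PbarY_superlinear[OF assms] by blast
  moreover have "\<Phi> \<in> Pbar" using assms by (simp add: PbarY_def)
  ultimately show thesis by (intro that growth_function.intro)
qed

section \<open>Necessity of the condition on \<open>\<rho>\<close>\<close>

text \<open>Moving \<open>x\<close> towards the origin by the factor \<open>1 - t / r\<close> gives
  the centre of a ball of radius \<open>t\<close> that still contains \<open>x\<close> and stays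
  inside the large ball; there the indicator has average 1.\<close>

lemma rho_le_frac_max_indicator:
  fixes x :: "'a::euclidean_space"
  assumes x: "x \<in> ball 0 r" and t: "0 < t" "t \<le> r"
  shows "ennreal (\<rho> t) \<le> frac_max \<rho> (indicator (ball 0 r)) x"
proof -
  define z where "z = (1 - t / r) *\<^sub>R x"
  have r: "0 < r" using t by simp
  have nx: "norm x < r" using x by simp
  have nz: "norm z = (1 - t / r) * norm x"
    using t r by (simp add: z_def)
  have "norm z \<le> (1 - t / r) * r"
    unfolding nz using nx t r by (intro mult_left_mono) auto
  also have "\<dots> = r - t" using r by (simp add: field_simps)
  finally have zt: "norm z + t \<le> r" by simp
  have sub: "ball z t \<subseteq> ball 0 r"
  proof
    fix y assume "y \<in> ball z t"
    then show "y \<in> ball 0 r"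
      using zt dist_triangle[of 0 y z] by simp
  qed
  have "z - x = - ((t / r) *\<^sub>R x)" by (simp add: z_def scaleR_diff_left)
  then have "dist z x = t / r * norm x" using t r by (simp add: dist_norm)
  also have "\<dots> < t" using nx t r by (simp add: field_simps)
  finally have xz: "x \<in> ball z t" by simp
  have "(\<integral>\<^sup>+y\<in>ball z t. ennreal \<bar>indicator (ball 0 r) y\<bar> \<partial>lebesgue) = (\<integral>\<^sup>+y. indicator (ball z t) y \<partial>lebesgue)"
    using sub by (intro nn_integral_cong) (auto split: split_indicator)
  also have "\<dots> = emeasure lebesgue (ball z t)" by simp
  finally have "ball_avg (indicator (ball 0 r)) z t = 1"
    using emeasure_lebesgue_ball_pos[OF t(1), of z] by (simp add: ball_avg_def)
  then show ?thesis
    unfolding frac_max_def using t xz by (intro SUP_upper2[of "(z, t)"]) auto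
qed

text \<open>Multiplication by \<open>a\<close> commutes with suprema. This lets an infinite inverse
  of \<open>\<Phi>\<close> be treated through finite \<open>s\<close> below it.\<close>

lemma Sup_times_le_ennreal:
  fixes a b c :: ennreal
  assumes "\<And>s. s < b \<Longrightarrow> a * s \<le> c"
  shows "a * b \<le> c"
proof -
  have "a * b = a * (SUP s\<in>{..<b}. s)" by simp
  also have "\<dots> = (SUP s\<in>{..<b}. a * s)" by (rule SUP_mult_left_ennreal)
  also have "\<dots> \<le> c" using assms by (intro SUP_least) auto
  finally show ?thesis .
qed

text \<open>For \<open>s\<close> below the inverse of \<open>\<Phi>\<close>, the indicator of the
  ball has norm at most \<open>\<kappa> / s\<close>, while \<open>frac_max\<close> of it is at least
  \<open>?R\<close> on the whole ball. The weak bound on this ball yields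
  \<open>\<Psi> (?R / d)\<close> times its measure at most 1, that is, a bound on \<open>?R\<close>
  by the inverse of \<open>\<Psi>\<close>.\<close>

lemma cond_i_of_bounded_weak:
  assumes P: "growth_function \<Phi> K" and Q: "growth_function \<Psi> L"
    and bdd: "bounded_weak (frac_max \<rho> :: ('a::euclidean_space \<Rightarrow> real) \<Rightarrow> 'a \<Rightarrow> ennreal) \<Phi> \<Psi>"
  obtains A where "0 < A" "cond_i \<rho> \<Phi> \<Psi> DIM('a) A"
proof -
  interpret P: growth_function \<Phi> K by fact
  interpret Q: growth_function \<Psi> L by fact
  obtain C where C: "0 < C" and weak: "\<And>f :: 'a \<Rightarrow> real. f \<in> orlicz_space \<Phi> \<Longrightarrow>
      weak_orlicz_norm \<Psi> (frac_max \<rho> f) \<le> ennreal C * orlicz_norm \<Phi> (\<lambda>x. ennreal \<bar>f x\<bar>)"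
    using bdd by (auto simp: bounded_weak_def)
  define \<kappa> where "\<kappa> = K * max 1 (unit_ball_vol DIM('a))"
  have \<kappa>: "0 < \<kappa>" using P.K by (simp add: \<kappa>_def)
  define \<beta> where "\<beta> = L * max 1 (1 / unit_ball_vol DIM('a))"
  have \<beta>: "0 < \<beta>" using Q.K by (simp add: \<beta>_def)
  \<comment> \<open>\<open>\<kappa>\<close> and \<open>\<beta>\<close> come from comparing
    \<open>r^n\<close> with the measure of the ball, once for each function; the 2 makes room for an
    admissible \<open>d\<close> strictly above the infimum.\<close>
  define A where "A = 2 * C * \<kappa> * \<beta>"
  have A: "0 < A" using C \<kappa> \<beta> by (simp add: A_def)
  have "cond_i \<rho> \<Phi> \<Psi> DIM('a) A"
    unfolding cond_i_def
  proof (intro allI impI, rule Sup_times_le_ennreal)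
    fix r :: real and s
    assume r: "0 < r" and s: "s < gen_inv \<Phi> (ennreal (1 / r ^ DIM('a)))"
    let ?R = "SUP t\<in>{0<..r}. ennreal (\<rho> t)"
    let ?G = "gen_inv \<Psi> (ennreal (1 / r ^ DIM('a)))"
    let ?B = "ball 0 r :: 'a set"
    let ?f = "indicator ?B :: 'a \<Rightarrow> real"
    show "?R * s \<le> ennreal A * ?G"
    proof (cases "s = 0")
      case False
      then obtain \<sigma> where \<sigma>: "s = ennreal \<sigma>" "0 < \<sigma>"
        using s by (cases s) auto
      define c where "c = \<kappa> / \<sigma>"
      have c: "0 < c" using \<kappa> \<sigma> by (simp add: c_def)
      have "(\<integral>\<^sup>+x. \<Phi> (ennreal \<bar>?f x\<bar> / ennreal c) \<partial>lebesgue)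
          = (\<integral>\<^sup>+x. \<Phi> (s / ennreal \<kappa>) * indicator ?B x \<partial>lebesgue)"
        using c \<kappa> \<sigma> by (intro nn_integral_cong) (auto simp: divide_ennreal c_def P.zero split: split_indicator)
      also have "\<dots> = \<Phi> (s / ennreal \<kappa>) * emeasure lebesgue ?B"
        by (simp add: nn_integral_cmult_indicator)
      also have "\<dots> \<le> 1"
        unfolding \<kappa>_def using s by (intro P.ball_le_of_le_gen_inv r) auto
      finally have int: "(\<integral>\<^sup>+x. \<Phi> (ennreal \<bar>?f x\<bar> / ennreal c) \<partial>lebesgue) \<le> 1" .
      have "?f \<in> orlicz_space \<Phi>"
      proof -
        have "(\<integral>\<^sup>+x. \<Phi> (ennreal (1 / c * \<bar>?f x\<bar>)) \<partial>lebesgue)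
            = (\<integral>\<^sup>+x. \<Phi> (ennreal \<bar>?f x\<bar> / ennreal c) \<partial>lebesgue)"
          using c by (intro nn_integral_cong) (simp add: divide_ennreal)
        also have "\<dots> < top" using int by (rule le_less_trans) simp
        finally have fin: "(\<integral>\<^sup>+x. \<Phi> (ennreal (1 / c * \<bar>?f x\<bar>)) \<partial>lebesgue) < top" .
        have "?f \<in> borel_measurable lebesgue" by (rule borel_measurable_indicator) simp
        moreover have "0 < 1 / c" using c by simp
        ultimately show ?thesis using fin unfolding orlicz_space_def by blast
      qed
      then have "weak_orlicz_norm \<Psi> (frac_max \<rho> ?f) \<le> ennreal C * orlicz_norm \<Phi> (\<lambda>x. ennreal \<bar>?f x\<bar>)"
        by (rule weak)
      also have "\<dots> \<le> ennreal C * ennreal c"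
        by (intro mult_left_mono orlicz_norm_le c int) simp
      also have "\<dots> < ennreal (2 * C * c)"
        using C c by (simp add: ennreal_mult[symmetric] ennreal_less_iff)
      finally obtain d where d: "0 < d" "ennreal d < ennreal (2 * C * c)"
        and wk: "(SUP t\<in>{0<..}. \<Psi> t * distrib (\<lambda>x. frac_max \<rho> ?f x / ennreal d) t) \<le> 1"
        by (auto simp: weak_orlicz_norm_def Inf_less_iff)
      have b: "0 < emeasure lebesgue ?B" "emeasure lebesgue ?B < top"
        using emeasure_lebesgue_ball_pos[OF r] by blast+
      have "\<Psi> (?R / ennreal d) \<le> 1 / emeasure lebesgue ?B"
      \<comment> \<open>The distribution function counts strict inequalities, so only
        \<open>t\<close> strictly below \<open>?R / d\<close> can be tested; left continuity
        supplies the endpoint, also when \<open>?R\<close> is infinite.\<close>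
      proof (rule Q.lsc)
        fix t assume t: "t < ?R / ennreal d"
        have "\<Psi> t * emeasure lebesgue ?B \<le> 1"
        proof (cases "t = 0")
          case False
          have "?B \<subseteq> {x. t < frac_max \<rho> ?f x / ennreal d}"
          proof
            fix x assume x: "x \<in> ?B"
            have "?R \<le> frac_max \<rho> ?f x"
              by (rule SUP_least) (use rho_le_frac_max_indicator[OF x] in auto)
            then have "?R / ennreal d \<le> frac_max \<rho> ?f x / ennreal d"
              by (rule divide_right_mono_ennreal)
            then show "x \<in> {x. t < frac_max \<rho> ?f x / ennreal d}" using t by auto
          qed
          moreover have "(\<lambda>x. frac_max \<rho> ?f x / ennreal d) \<in> borel_measurable lebesgue"
            by (intro borel_measurable_divide_ennreal frac_max_measurable) simp
          from borel_measurable_less[OF borel_measurable_const this, of t]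
          have "{x. t < frac_max \<rho> ?f x / ennreal d} \<in> sets lebesgue" by simp
          ultimately have "emeasure lebesgue ?B \<le> distrib (\<lambda>x. frac_max \<rho> ?f x / ennreal d) t"
            unfolding distrib_def by (rule emeasure_mono)
          then have "\<Psi> t * emeasure lebesgue ?B \<le> \<Psi> t * distrib (\<lambda>x. frac_max \<rho> ?f x / ennreal d) t"
            by (rule mult_left_mono) simp
          also have "\<dots> \<le> (SUP t\<in>{0<..}. \<Psi> t * distrib (\<lambda>x. frac_max \<rho> ?f x / ennreal d) t)"
            using False by (intro SUP_upper) (simp add: zero_less_iff_neq_zero)
          also note wk
          finally show ?thesis .
        qed (simp add: Q.zero)
        then show "\<Psi> t \<le> 1 / emeasure lebesgue ?B" using le_divide_iff_ennreal[OF b] by blast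
      qed
      then have "\<Psi> (?R / ennreal d) * emeasure lebesgue ?B \<le> 1"
        using le_divide_iff_ennreal[OF b] by blast
      then have "?R / ennreal d \<le> ennreal \<beta> * ?G"
        unfolding \<beta>_def by (rule Q.le_gen_inv_ball[OF r])
      then have "?R \<le> ennreal \<beta> * ?G * ennreal d"
        using d by (subst (asm) divide_le_iff_ennreal) auto
      also have "\<dots> \<le> ennreal \<beta> * ?G * ennreal (2 * C * c)"
        using d by (intro mult_left_mono) auto
      finally have "?R * s \<le> ennreal \<beta> * ?G * ennreal (2 * C * c) * s"
        by (rule mult_right_mono) simp
      also have "\<dots> = (ennreal \<beta> * ennreal (2 * C * c) * ennreal \<sigma>) * ?G"
        unfolding \<sigma> by (simp only: ac_simps)
      also have "ennreal \<beta> * ennreal (2 * C * c) * ennreal \<sigma> = ennreal A"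
        using \<beta> C c \<sigma> \<kappa> by (simp add: ennreal_mult[symmetric] A_def c_def)
      finally show ?thesis .
    qed simp
  qed
  with A show thesis by (rule that)
qed

text \<open>Functions are identified when they agree almost everywhere, so a nonzero function is one
  that is not null almost everywhere; otherwise the norm in the denominators would be 0.\<close>

theorem theorem3p8:
  fixes \<rho> :: "real \<Rightarrow> real" and \<Phi> \<Psi> :: "ennreal \<Rightarrow> ennreal"
  assumes rho_pos: "\<forall>t>0. \<rho> t > 0"
    and Phi: "\<Phi> \<in> PbarY" and Psi: "\<Psi> \<in> PbarY"
  shows "((\<exists>A>0. cond_i \<rho> \<Phi> \<Psi> DIM('a::euclidean_space) A) \<longrightarrow>
            (\<forall>C0::real>0. \<exists>C1::real>0. \<forall>(f::'a \<Rightarrow> real)\<in>orlicz_space \<Phi>. \<forall>x.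
                \<not> (AE y in lebesgue. f y = 0) \<longrightarrow>
                \<Psi> (frac_max \<rho> f x / (ennreal C1 * orlicz_norm \<Phi> (\<lambda>y. ennreal \<bar>f y\<bar>)))
                  \<le> \<Phi> (HL_max f x / (ennreal C0 * orlicz_norm \<Phi> (\<lambda>y. ennreal \<bar>f y\<bar>))))
          \<and> bounded_weak (frac_max \<rho> :: ('a \<Rightarrow> real) \<Rightarrow> 'a \<Rightarrow> ennreal) \<Phi> \<Psi>
          \<and> (\<Phi> \<in> nabla2 \<longrightarrow> bounded_strong (frac_max \<rho> :: ('a \<Rightarrow> real) \<Rightarrow> 'a \<Rightarrow> ennreal) \<Phi> \<Psi>))
       \<and> (bounded_weak (frac_max \<rho> :: ('a \<Rightarrow> real) \<Rightarrow> 'a \<Rightarrow> ennreal) \<Phi> \<Psi> \<longrightarrow>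
            (\<exists>A>0. cond_i \<rho> \<Phi> \<Psi> DIM('a) A))"
proof -
  obtain K where P: "growth_function \<Phi> K" using PbarY_growth_function[OF Phi] .
  obtain L where Q: "growth_function \<Psi> L" using PbarY_growth_function[OF Psi] .
  interpret P: growth_function \<Phi> K by fact
  interpret Q: growth_function \<Psi> L by fact
  show ?thesis
  proof (intro conjI impI allI)
    fix C0 :: real
    assume "\<exists>A>0. cond_i \<rho> \<Phi> \<Psi> DIM('a) A" and C0: "0 < C0"
    then obtain A where A: "0 < A" "cond_i \<rho> \<Phi> \<Psi> DIM('a) A" by blast
    from P.frac_max_pointwise[OF Q.Pbar A C0]
    show "\<exists>C1::real>0. \<forall>(f::'a \<Rightarrow> real)\<in>orlicz_space \<Phi>. \<forall>x.
        \<not> (AE y in lebesgue. f y = 0) \<longrightarrow>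
        \<Psi> (frac_max \<rho> f x / (ennreal C1 * orlicz_norm \<Phi> (\<lambda>y. ennreal \<bar>f y\<bar>)))
          \<le> \<Phi> (HL_max f x / (ennreal C0 * orlicz_norm \<Phi> (\<lambda>y. ennreal \<bar>f y\<bar>)))"
      by metis
  qed (use P.frac_max_bounded_weak[OF Q.Pbar] P.frac_max_bounded_strong[OF Q.Pbar]
      cond_i_of_bounded_weak[OF P Q] in blast)+
qed

end
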